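(* Let $\mathrm{HL}:\Gamma(\mathbb{S}^1)\to\Gamma(\mathbb{H}^2)$ be the linear operator $X\mapsto \mathrm{J}\,\mathrm{grad}(u_X)$ and let $L_0$ be the infinitesimal Douady-Earle extension. Then for every continuous vector field $X$ on the circle, $G_*\mathrm{HL}(X)=L_0(X)$, where $G:\mathbb{H}^2\to\mathbb{B}^2$ is the isometry from the hyperboloid model to the Poincaré disk model.
   Context: Minkowski space $\mathbb{R}^{1,2}$ is $\mathbb{R}^3$ with $\langle x,y\rangle_{1,2}=-x_0y_0+x_1y_1+x_2y_2$. The hyperbolic plane is $\mathbb{H}^2=\{x\in\mathbb{R}^{1,2}: \langle x,x\rangle_{1,2}=-1,\ x_0>0\}$ with the induced Riemannian metric and complex structure $\mathrm{J}_p(v)=p\boxtimes v$, where $\langle x\boxtimes y,v\rangle_{1,2}=\det(x,y,v)$ for all $v$. $\mathrm{grad}$ and $\Delta$ are the gradient and Laplace-Beltrami operator ($\Delta=\mathrm{tr}\,\mathrm{Hess}$) of $\mathbb{H}^2$. $\Gamma(\mathbb{S}^1)$, $\Gamma(\mathbb{H}^2)$ denote the spaces of continuous vector fields. $\mathbb{D}^2\subset\mathbb{R}^2$ is the open unit disk, $\Pi:\mathbb{H}^2\to\mathbb{D}^2$, $\Pi(x_0,x_1,x_2)=(x_1/x_0,x_2/x_0)$, and for $u:\mathbb{H}^2\to\mathbb{R}$ set $\overline{u}(\eta)=\sqrt{1-|\eta|^2}\,u(\Pi^{-1}(\eta))$, $\eta\in\mathbb{D}^2$. A continuous vector field $X$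 on $\mathbb{S}^1\subset\mathbb{C}$ has support function $\phi_X:\mathbb{S}^1\to\mathbb{R}$ defined by $X(z)=iz\,\phi_X(z)$. It is known that there is a unique smooth $u_X:\mathbb{H}^2\to\mathbb{R}$ with $\Delta u_X-2u_X=0$ and such that $\overline{u_X}$ extends continuously to $\overline{\mathbb{D}^2}$ with $\overline{u_X}|_{\mathbb{S}^1}=\phi_X$. $\mathbb{B}^2$ is the Poincaré disk (unit disk in $\mathbb{C}$), and $G(x_0,x_1,x_2)=\left(\frac{x_1}{1+x_0},\frac{x_2}{1+x_0}\right)$; $(G_*V)(z)=\mathrm{d}G(V(G^{-1}(z)))$. The infinitesimal Douady-Earle extension of $X$ is the vector field on $\mathbb{B}^2$ given by $$L_0(X)(z)=\frac{(1-|z|^2)^3}{2i\pi}\int_{\mathbb{S}^1}\frac{X(x)}{(1-\overline{z}x)^3(x-z)}\,dx ,$$ where $X$ is regarded as a $\mathbb{C}$-valued function and $dx$ is the complex line element, $\mathbb{S}^1$ being oriented counterclockwise. *)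

theory Defs
  imports "HOL-Analysis.Analysis" "HOL-Complex_Analysis.Contour_Integration"
begin

section \<open>Minkowski space and the hyperboloid\<close>

text \<open>The coordinates \<open>x\<^sub>0, x\<^sub>1, x\<^sub>2\<close> of the mathematics are the components
  \<open>x $ 1, x $ 2, x $ 3\<close> here.\<close>

definition mink :: "real^3 \<Rightarrow> real^3 \<Rightarrow> real" where
  "mink x y = - (x $ 1) * (y $ 1) + (x $ 2) * (y $ 2) + (x $ 3) * (y $ 3)"

definition hyp_plane :: "(real^3) set" where
  "hyp_plane = {x. mink x x = -1 \<and> x $ 1 > 0}"

definition hyp_tangent :: "real^3 \<Rightarrow> (real^3) set" where
  "hyp_tangent p = {v. mink p v = 0}"

definition boxtimes :: "real^3 \<Rightarrow> real^3 \<Rightarrow> real^3" where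
  "boxtimes x y = (THE w. \<forall>v. mink w v = det (vector [x, y, v] :: real^3^3))"

definition hyp_J :: "real^3 \<Rightarrow> real^3 \<Rightarrow> real^3" where
  "hyp_J p v = boxtimes p v"

lemma mink_boxtimes: "mink (boxtimes x y) v = det (vector [x, y, v] :: real^3^3)"
proof -
  define w :: "real^3" where "w = vector [x$3 * y$2 - x$2 * y$3, x$3 * y$1 - x$1 * y$3, x$1 * y$2 - x$2 * y$1]"
  have "\<forall>v. mink w v = det (vector [x, y, v] :: real^3^3)"
    by (simp add: w_def mink_def det_3 algebra_simps)
  moreover have "w' = w''" if eq: "\<And>v. mink w' v = mink w'' v" for w' w'' :: "real^3"
    using eq[of "axis 1 1"] eq[of "axis 2 1"] eq[of "axis 3 1"]
    by (simp add: mink_def axis_def vec_eq_iff forall_3)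
  ultimately have "\<exists>!w. \<forall>v. mink w v = det (vector [x, y, v] :: real^3^3)"
    by metis
  from theI'[OF this] show ?thesis
    by (simp add: boxtimes_def)
qed


section \<open>Calculus on the hyperboloid\<close>

text \<open>Functions and vector fields on the hyperboloid are functions on \<open>real^3\<close> of which only the
  values on \<open>hyp_plane\<close> matter. The differential at \<open>p\<close> is a derivative within \<open>hyp_plane\<close>;
  such a derivative is not unique as a linear map on \<open>real^3\<close>, but its values on tangent vectors
  are (lemma \<open>hyp_diff_unique\<close>), and \<open>hyp_diff\<close> is only used on those.\<close>

definition hyp_diff :: "(real^3 \<Rightarrow> 'b::real_normed_vector) \<Rightarrow> real^3 \<Rightarrow> real^3 \<Rightarrow> 'b" where
  "hyp_diff f p v = frechet_derivative f (at p within hyp_plane) v"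

lemma hyp_diff_unique:
  fixes f :: "real^3 \<Rightarrow> 'b::real_normed_vector"
  assumes D: "(f has_derivative D) (at p within hyp_plane)"
    and p: "p \<in> hyp_plane" and v: "v \<in> hyp_tangent p"
  shows "hyp_diff f p v = D v"
proof -
  define c where "c t = sqrt (1 + t\<^sup>2 * mink v v) *\<^sub>R p + t *\<^sub>R v" for t :: real
  define S where "S = {t::real. 1 + t\<^sup>2 * mink v v > 0 \<and> c t $ 1 > 0}"
  have c0: "c 0 = p" by (simp add: c_def)
  have openS: "open S"
    unfolding S_def c_def by (intro open_Collect_conj open_Collect_less continuous_intros)
  have 0: "0 \<in> S" using p by (simp add: S_def c0 hyp_plane_def)
  have sub: "c ` S \<subseteq> hyp_plane"
  proof
    fix y assume "y \<in> c ` S"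
    then obtain t where t: "t \<in> S" "y = c t" by blast
    have "mink (a *\<^sub>R p + b *\<^sub>R v) (a *\<^sub>R p + b *\<^sub>R v) = a\<^sup>2 * mink p p + 2 * a * b * mink p v + b\<^sup>2 * mink v v"
      for a b by (simp add: mink_def algebra_simps power2_eq_square)
    then have "mink (c t) (c t) = -1"
      using t p v by (simp add: c_def S_def hyp_plane_def hyp_tangent_def)
    then show "y \<in> hyp_plane" using t by (simp add: S_def hyp_plane_def)
  qed
  have dc: "(c has_derivative (\<lambda>t. t *\<^sub>R v)) (at 0 within S)"
    unfolding c_def by (auto intro!: derivative_eq_intros)
  have *: "((f \<circ> c) has_vector_derivative E v) (at 0)"
    if E: "(f has_derivative E) (at p within hyp_plane)" for E
  proof -
    have "(f has_derivative E) (at (c 0) within c ` S)"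
      using has_derivative_subset[OF E sub] by (simp add: c0)
    from diff_chain_within[OF dc this]
    have "((f \<circ> c) has_derivative (\<lambda>t. E (t *\<^sub>R v))) (at 0)"
      using at_within_open[OF 0 openS] by (simp add: o_def)
    then show ?thesis
      using has_derivative_bounded_linear[OF E]
      by (simp add: has_vector_derivative_def linear_simps)
  qed
  have "f differentiable (at p within hyp_plane)" using D by (rule differentiableI)
  then show ?thesis
    unfolding hyp_diff_def
    using vector_derivative_unique_at[OF *[OF D] *] by (simp add: frechet_derivative_works)
qed

definition hyp_grad :: "(real^3 \<Rightarrow> real) \<Rightarrow> real^3 \<Rightarrow> real^3" where
  "hyp_grad u p = (THE w. w \<in> hyp_tangent p \<and> (\<forall>v\<in>hyp_tangent p. mink w v = hyp_diff u p v))"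

text \<open>The Levi-Civita connection of the induced metric is the tangential part of the flat
  derivative; as \<open>mink p p = -1\<close>, the tangential part of \<open>w\<close> at \<open>p\<close> is \<open>w + mink w p *\<^sub>R p\<close>.\<close>

definition hyp_proj :: "real^3 \<Rightarrow> real^3 \<Rightarrow> real^3" where
  "hyp_proj p w = w + mink w p *\<^sub>R p"

definition hyp_nabla :: "(real^3 \<Rightarrow> real^3) \<Rightarrow> real^3 \<Rightarrow> real^3 \<Rightarrow> real^3" where
  "hyp_nabla V p v = hyp_proj p (hyp_diff V p v)"

definition hyp_hess :: "(real^3 \<Rightarrow> real) \<Rightarrow> real^3 \<Rightarrow> real^3 \<Rightarrow> real^3 \<Rightarrow> real" where
  "hyp_hess u p v w = mink (hyp_nabla (hyp_grad u) p v) w"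

definition hyp_frame :: "real^3 \<Rightarrow> real^3 \<Rightarrow> real^3 \<Rightarrow> bool" where
  "hyp_frame p e1 e2 \<longleftrightarrow> e1 \<in> hyp_tangent p \<and> e2 \<in> hyp_tangent p \<and>
     mink e1 e1 = 1 \<and> mink e2 e2 = 1 \<and> mink e1 e2 = 0"

text \<open>The trace, i.e. the common value of the sum over all orthonormal frames.\<close>

definition hyp_laplace :: "(real^3 \<Rightarrow> real) \<Rightarrow> real^3 \<Rightarrow> real" where
  "hyp_laplace u p =
     (THE s. \<forall>e1 e2. hyp_frame p e1 e2 \<longrightarrow> s = hyp_hess u p e1 e1 + hyp_hess u p e2 e2)"

fun Ck_on :: "nat \<Rightarrow> ('a::euclidean_space \<Rightarrow> real) \<Rightarrow> 'a set \<Rightarrow> bool" where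
  "Ck_on 0 f S \<longleftrightarrow> continuous_on S f"
| "Ck_on (Suc k) f S \<longleftrightarrow>
     (\<forall>x\<in>S. f differentiable (at x)) \<and> (\<forall>b\<in>Basis. Ck_on k (\<lambda>x. frechet_derivative f (at x) b) S)"

text \<open>Smooth functions on the embedded submanifold \<open>hyp_plane\<close>: those extending to a
  \<open>C\<^sup>\<infinity>\<close> function on an open neighbourhood.\<close>

definition hyp_smooth :: "(real^3 \<Rightarrow> real) \<Rightarrow> bool" where
  "hyp_smooth u \<longleftrightarrow> (\<exists>W U. open W \<and> hyp_plane \<subseteq> W \<and> (\<forall>k. Ck_on k U W) \<and> (\<forall>p\<in>hyp_plane. u p = U p))"


section \<open>Vector fields on the circle and the operator HL\<close>

text \<open>\<open>\<real>\<^sup>2\<close> is identified with \<open>\<complex>\<close> throughout; both disks are \<open>ball 0 1 :: complex set\<close>.\<close>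

definition circle_fields :: "(complex \<Rightarrow> complex) set" where
  "circle_fields = {X. continuous_on (sphere 0 1) X \<and> (\<forall>z\<in>sphere 0 1. X z \<bullet> z = 0)}"

definition support_fun :: "(complex \<Rightarrow> complex) \<Rightarrow> complex \<Rightarrow> real" where
  "support_fun X z = (THE r. X z = \<i> * z * complex_of_real r)"

definition klein_map :: "real^3 \<Rightarrow> complex" where
  "klein_map x = Complex (x $ 2 / x $ 1) (x $ 3 / x $ 1)"

definition disk_fun :: "(real^3 \<Rightarrow> real) \<Rightarrow> complex \<Rightarrow> real" where
  "disk_fun u \<eta> = sqrt (1 - (cmod \<eta>)\<^sup>2) * u (inv_into hyp_plane klein_map \<eta>)"

definition has_boundary_values :: "(real^3 \<Rightarrow> real) \<Rightarrow> (complex \<Rightarrow> real) \<Rightarrow> bool" where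
  "has_boundary_values u \<phi> \<longleftrightarrow>
     (\<exists>f. continuous_on (cball 0 1) f \<and> (\<forall>\<eta>\<in>ball 0 1. f \<eta> = disk_fun u \<eta>) \<and>
          (\<forall>z\<in>sphere 0 1. f z = \<phi> z))"

text \<open>Membership in \<open>extensional hyp_plane\<close> fixes the irrelevant values off the hyperboloid, so
  that uniqueness of the function on the hyperboloid is uniqueness of the HOL function.\<close>

definition u_of :: "(complex \<Rightarrow> complex) \<Rightarrow> real^3 \<Rightarrow> real" where
  "u_of X = (THE u. u \<in> extensional hyp_plane \<and> hyp_smooth u \<and>
      (\<forall>p\<in>hyp_plane. hyp_laplace u p - 2 * u p = 0) \<and>
      has_boundary_values u (support_fun X))"

definition HL :: "(complex \<Rightarrow> complex) \<Rightarrow> real^3 \<Rightarrow> real^3" where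
  "HL X p = hyp_J p (hyp_grad (u_of X) p)"


section \<open>The Poincare disk and the infinitesimal Douady-Earle extension\<close>

definition poincare_map :: "real^3 \<Rightarrow> complex" where
  "poincare_map x = Complex (x $ 2 / (1 + x $ 1)) (x $ 3 / (1 + x $ 1))"

definition poincare_push :: "(real^3 \<Rightarrow> real^3) \<Rightarrow> complex \<Rightarrow> complex" where
  "poincare_push V z =
     (let p = inv_into hyp_plane poincare_map z in hyp_diff poincare_map p (V p))"

definition L0 :: "(complex \<Rightarrow> complex) \<Rightarrow> complex \<Rightarrow> complex" where
  "L0 X z = of_real ((1 - (cmod z)\<^sup>2) ^ 3) / (2 * \<i> * of_real pi) *
     contour_integral (circlepath 0 1) (\<lambda>x. X x / ((1 - cnj z * x) ^ 3 * (x - z)))"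

end

theory Submission
  imports Defs "HOL-Complex_Analysis.Cauchy_Integral_Formula"
begin

text \<open>The function \<open>u_of X\<close> has an explicit integral formula, and the theorem is then an identity
  between integrands. For a null vector \<open>\<ell> = (1, cos \<theta>, sin \<theta>)\<close> the function \<open>(- mink p \<ell>)\<^sup>s\<close> on
  the hyperboloid is an eigenfunction of the Laplacian with eigenvalue \<open>s * (s + 1)\<close>; the exponent
  \<open>s = -2\<close> gives the eigenvalue 2. Hence
  \<open>u p = 1 / (2 * pi) * (integral of \<phi> (cis \<theta>) * (- mink p \<ell>)^(-2) d\<theta>)\<close>
  is a smooth solution of \<open>\<Delta>u = 2u\<close> (\<open>Ck_on_wave\<close>, \<open>hyp_laplace_wave\<close>).

  Its boundary values are \<open>\<phi>\<close>: the operator is positive, and on the functions \<open>1, cos, sin\<close> it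
  returns the coordinates of \<open>p\<close> (\<open>wave_first_harmonics\<close>, from Cauchy's integral formula), so in
  the Klein disk it reproduces affine functions. By Korovkin's argument these two facts already give
  continuity up to the circle (\<open>wave_boundary_values\<close>). A solution is determined by its boundary
  values by a maximum principle for the ratio \<open>u / x\<^sub>0\<close>, proved by means of second derivatives along
  geodesics (\<open>hyp_laplace_comparison\<close>). Therefore \<open>u_of X\<close> is this integral (\<open>u_of_eq\<close>).

  Finally the linear operator \<open>dG \<circ> J \<circ> grad\<close> is applied under the integral sign. In the coordinate
  \<open>z\<close> of the Poincare disk, with \<open>x = cis \<theta>\<close>, one has \<open>- mink p \<ell> = (cmod (x - z))\<^sup>2 / (1 - (cmod z)\<^sup>2)\<close>, and
  the rotated gradient of the kernel is \<open>\<i> * (x - z)\<^sup>2 * cnj x * (- mink p \<ell>)^(-3)\<close> (\<open>rotated_kernel\<close>).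
  On the circle \<open>(x - z) * (1 - cnj z * x) = x * (cmod (x - z))\<^sup>2\<close>, and this turns the integrand into that of
  \<open>L0 X z\<close>.\<close>

section \<open>Minkowski linear algebra, gradient and Hessian\<close>

text \<open>Together with \<open>p\<close> the frame is a Minkowski-orthonormal basis: with \<open>E\<close> the matrix of rows
  \<open>p, e1, e2\<close> and \<open>\<eta> = diag (-1, 1, 1)\<close> this is \<open>E \<eta> E\<^sup>T = \<eta>\<close>. A right inverse of a square
  matrix is a left inverse, so also \<open>E\<^sup>T \<eta> E = \<eta>\<close>, which is the claim. It shows that traces over
  frames do not depend on the frame.\<close>

lemma hyp_frame_trace:
  assumes p: "p \<in> hyp_plane" and e: "hyp_frame p e1 e2"
  shows "(e1 \<bullet> a) * (e1 \<bullet> b) + (e2 \<bullet> a) * (e2 \<bullet> b) = mink a b + (p \<bullet> a) * (p \<bullet> b)"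
proof -
  define A :: "real^3^3" where "A = vector [p, e1, e2]"
  define B :: "real^3^3" where "B = vector
    [vector [p$1, - (e1$1), - (e2$1)], vector [- (p$2), e1$2, e2$2], vector [- (p$3), e1$3, e2$3]]"
  have "A ** B = mat 1"
    using p e
    by (simp add: A_def B_def vec_eq_iff forall_3 matrix_matrix_mult_def sum_3 mat_def
        hyp_plane_def hyp_frame_def hyp_tangent_def mink_def algebra_simps)
  then have "B ** A = mat 1"
    by (simp add: matrix_left_right_inverse)
  then have *: "\<And>i j. (\<Sum>k\<in>UNIV. B $ i $ k * A $ k $ j) = (if i = j then 1 else 0)"
    by (simp add: vec_eq_iff matrix_matrix_mult_def mat_def)
  have c: "e1$1 * e1$1 + e2$1 * e2$1 = p$1 * p$1 - 1" "e1$1 * e1$2 + e2$1 * e2$2 = p$1 * p$2"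
    "e1$1 * e1$3 + e2$1 * e2$3 = p$1 * p$3"
    "e1$2 * e1$2 + e2$2 * e2$2 = p$2 * p$2 + 1" "e1$2 * e1$3 + e2$2 * e2$3 = p$2 * p$3"
    "e1$3 * e1$3 + e2$3 * e2$3 = p$3 * p$3 + 1"
    using *[of 1 1] *[of 1 2] *[of 1 3] *[of 2 2] *[of 2 3] *[of 3 3]
    by (simp_all add: sum_3 A_def B_def algebra_simps)
  have "(e1 \<bullet> a) * (e1 \<bullet> b) + (e2 \<bullet> a) * (e2 \<bullet> b)
    = (a$1 * b$1) * (e1$1 * e1$1 + e2$1 * e2$1) + (a$1 * b$2 + a$2 * b$1) * (e1$1 * e1$2 + e2$1 * e2$2)
    + (a$1 * b$3 + a$3 * b$1) * (e1$1 * e1$3 + e2$1 * e2$3) + (a$2 * b$2) * (e1$2 * e1$2 + e2$2 * e2$2)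
    + (a$2 * b$3 + a$3 * b$2) * (e1$2 * e1$3 + e2$2 * e2$3) + (a$3 * b$3) * (e1$3 * e1$3 + e2$3 * e2$3)"
    by (simp add: inner_vec_def sum_3 algebra_simps)
  also have "\<dots> = mink a b + (p \<bullet> a) * (p \<bullet> b)"
    unfolding c by (simp add: inner_vec_def sum_3 mink_def algebra_simps)
  finally show ?thesis .
qed

lemma hyp_plane_iff: "p \<in> hyp_plane \<longleftrightarrow> (p$1)\<^sup>2 = 1 + (p$2)\<^sup>2 + (p$3)\<^sup>2 \<and> p$1 > 0"
  by (auto simp: hyp_plane_def mink_def power2_eq_square)

lemma hyp_frame_exists:
  assumes p: "p \<in> hyp_plane"
  obtains e1 e2 where "hyp_frame p e1 e2"
proof -
  \<comment> \<open>The boost that carries the base point \<open>(1, 0, 0)\<close> to \<open>p\<close>, applied to the two spatial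
     coordinate vectors.\<close>
  define e1 :: "real^3" where "e1 = vector [p$2, 1 + (p$2)\<^sup>2 / (1 + p$1), p$2 * p$3 / (1 + p$1)]"
  define e2 :: "real^3" where "e2 = vector [p$3, p$2 * p$3 / (1 + p$1), 1 + (p$3)\<^sup>2 / (1 + p$1)]"
  have pos: "1 + p$1 > 0" and q: "(p$1)\<^sup>2 = 1 + (p$2)\<^sup>2 + (p$3)\<^sup>2"
    using p by (auto simp: hyp_plane_iff)
  obtain a b c where abc: "p$1 = a" "p$2 = b" "p$3 = c" by simp
  define k where "k = inverse (1 + a)"
  have k: "k * (1 + a) = 1" using pos abc by (simp add: k_def)
  have q': "a\<^sup>2 = 1 + b\<^sup>2 + c\<^sup>2" using q abc by simp
  have "hyp_frame p e1 e2"
    unfolding hyp_frame_def hyp_tangent_def mink_def e1_def e2_def mem_Collect_eq vector_3 abc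
      divide_inverse k_def[symmetric] power2_eq_square
    using k q'[unfolded power2_eq_square]
    by (intro conjI; algebra)
  then show thesis by (rule that)
qed

text \<open>Turns a Euclidean gradient, which represents a differential through \<open>\<bullet>\<close>, into the gradient
  with respect to \<open>mink\<close>.\<close>

definition mink_flip :: "real^3 \<Rightarrow> real^3" where
  "mink_flip a = vector [- (a$1), a$2, a$3]"

lemma bounded_linear_mink_flip: "bounded_linear mink_flip"
  by (intro linear_conv_bounded_linear[THEN iffD1] linearI)
     (simp_all add: mink_flip_def vec_eq_iff forall_3)

lemma mink_flip_left: "mink (mink_flip a) b = a \<bullet> b"
  by (simp add: mink_def mink_flip_def inner_vec_def sum_3)

lemma bounded_bilinear_mink: "bounded_bilinear mink"
  apply (rule bilinear_conv_bounded_bilinear[THEN iffD1])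
  apply (auto simp: bilinear_def mink_def algebra_simps intro!: linearI)
  done

lemma mink_sym: "mink a b = mink b a" by (simp add: mink_def)

lemma hyp_tangent_diff:
  "v \<in> hyp_tangent p \<Longrightarrow> w \<in> hyp_tangent p \<Longrightarrow> v - w \<in> hyp_tangent p"
  by (simp add: hyp_tangent_def bounded_bilinear.diff_right[OF bounded_bilinear_mink])

lemma hyp_proj_tangent: "p \<in> hyp_plane \<Longrightarrow> hyp_proj p w \<in> hyp_tangent p"
  by (simp add: hyp_plane_def hyp_tangent_def hyp_proj_def bounded_bilinear.add_right[OF bounded_bilinear_mink]
   bounded_bilinear.scaleR_right[OF bounded_bilinear_mink] mink_sym)

lemma mink_hyp_proj: "v \<in> hyp_tangent p \<Longrightarrow> mink (hyp_proj p w) v = mink w v"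
  by (simp add: hyp_tangent_def hyp_proj_def bounded_bilinear.add_left[OF bounded_bilinear_mink]
   bounded_bilinear.scaleR_left[OF bounded_bilinear_mink])

text \<open>A tangent vector orthogonal to \<open>hyp_tangent p\<close> is orthogonal to everything, as any vector
  differs from its tangential projection by a multiple of \<open>p\<close>. This gives the uniqueness that
  \<open>hyp_grad\<close> requires.\<close>

lemma hyp_tangent_nondegenerate:
  assumes p: "p \<in> hyp_plane" and w: "w \<in> hyp_tangent p" and "\<And>v. v \<in> hyp_tangent p \<Longrightarrow> mink w v = 0"
  shows "w = 0"
proof -
  have "mink w y = 0" for y
    using assms(3)[OF hyp_proj_tangent[OF p, of y]] mink_hyp_proj[OF w, of y] by (simp add: mink_sym)
  from this[of "axis 1 1"] this[of "axis 2 1"] this[of "axis 3 1"] show ?thesis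
    by (simp add: mink_def axis_def vec_eq_iff forall_3)
qed

lemma hyp_grad_eq:
  assumes p: "p \<in> hyp_plane" and D: "(u has_derivative (\<lambda>h. g \<bullet> h)) (at p within hyp_plane)"
  shows "hyp_grad u p = hyp_proj p (mink_flip g)"
  unfolding hyp_grad_def
proof (rule the_equality)
  have d: "hyp_diff u p v = g \<bullet> v" if "v \<in> hyp_tangent p" for v
    using hyp_diff_unique[OF D p that] .
  show *: "hyp_proj p (mink_flip g) \<in> hyp_tangent p \<and>
        (\<forall>v\<in>hyp_tangent p. mink (hyp_proj p (mink_flip g)) v = hyp_diff u p v)"
    using hyp_proj_tangent[OF p] by (auto simp: d mink_hyp_proj mink_flip_left)
  fix w assume w: "w \<in> hyp_tangent p \<and> (\<forall>v\<in>hyp_tangent p. mink w v = hyp_diff u p v)"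
  have "w - hyp_proj p (mink_flip g) = 0"
    using * w by (intro hyp_tangent_nondegenerate[OF p] hyp_tangent_diff)
       (auto simp: bounded_bilinear.diff_left[OF bounded_bilinear_mink])
  then show "w = hyp_proj p (mink_flip g)" by simp
qed

text \<open>Differentiating \<open>hyp_grad u x = mink_flip (g x) + (g x \<bullet> x) *\<^sub>R x\<close> produces, besides the ambient
  second derivative, multiples of \<open>p\<close>, which the projection kills, and the extra multiple
  \<open>(g p \<bullet> p) *\<^sub>R v\<close>, the contribution of the second fundamental form of the hyperboloid.\<close>

lemma hyp_hess_eq:
  assumes U: "\<And>x. x \<in> hyp_plane \<Longrightarrow> (u has_derivative (\<lambda>h. g x \<bullet> h)) (at x within hyp_plane)"
    and H: "(g has_derivative H) (at p within hyp_plane)"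
    and p: "p \<in> hyp_plane" and v: "v \<in> hyp_tangent p" and w: "w \<in> hyp_tangent p"
  shows "hyp_hess u p v w = H v \<bullet> w + (g p \<bullet> p) * mink v w"
proof -
  define D where "D h = mink_flip (H h) + ((g p \<bullet> h + H h \<bullet> p) *\<^sub>R p + (g p \<bullet> p) *\<^sub>R h)" for h
  have "((\<lambda>x. mink_flip (g x) + (g x \<bullet> x) *\<^sub>R x) has_derivative D) (at p within hyp_plane)"
    unfolding D_def
    by (rule derivative_eq_intros bounded_linear.has_derivative[OF bounded_linear_mink_flip] H refl)+
       (simp add: fun_eq_iff algebra_simps)
  then have "(hyp_grad u has_derivative D) (at p within hyp_plane)"
    by (rule has_derivative_transform[OF p, rotated])
       (simp add: hyp_grad_eq[OF _ U] hyp_proj_def mink_flip_left)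
  then have "hyp_diff (hyp_grad u) p v = D v"
    by (rule hyp_diff_unique[OF _ p v])
  moreover have "mink p w = 0" using w by (simp add: hyp_tangent_def)
  ultimately show ?thesis
    by (simp add: hyp_hess_def hyp_nabla_def mink_hyp_proj[OF w] D_def mink_flip_left
       bounded_bilinear.add_left[OF bounded_bilinear_mink]
       bounded_bilinear.scaleR_left[OF bounded_bilinear_mink])
qed

section \<open>Laplacian, geodesics and second derivatives\<close>

lemma Ck_on_gradient:
  assumes U: "Ck_on (Suc (Suc 0)) U W" and W: "open W"
  obtains g H where "\<And>x. x \<in> W \<Longrightarrow> (U has_derivative (\<lambda>h. g x \<bullet> h)) (at x)"
    and "\<And>x. x \<in> W \<Longrightarrow> (g has_derivative H x) (at x)"
proof -
  define g where "g x = (\<Sum>b\<in>Basis. frechet_derivative U (at x) b *\<^sub>R b)" for x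
  have "(U has_derivative (\<lambda>h. g x \<bullet> h)) (at x)" if "x \<in> W" for x
  proof -
    have D: "(U has_derivative frechet_derivative U (at x)) (at x)"
      using U that by (auto simp: frechet_derivative_works)
    interpret bounded_linear "frechet_derivative U (at x)" by (rule has_derivative_bounded_linear[OF D])
    have "frechet_derivative U (at x) h = g x \<bullet> h" for h
    proof -
      have "frechet_derivative U (at x) h = frechet_derivative U (at x) (\<Sum>b\<in>Basis. (h \<bullet> b) *\<^sub>R b)"
        by (simp add: euclidean_representation)
      also have "\<dots> = g x \<bullet> h"
        unfolding sum by (simp add: g_def inner_sum_left inner_sum_right scaleR inner_commute mult.commute)
      finally show ?thesis .
    qed
    then have "frechet_derivative U (at x) = (\<lambda>h. g x \<bullet> h)" by (rule ext)
    with D show ?thesis by simp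
  qed
  moreover have "(g has_derivative frechet_derivative g (at x)) (at x)" if "x \<in> W" for x
  proof -
    have "g differentiable (at x)"
      unfolding g_def using U that by (intro derivative_intros) auto
    then show ?thesis by (simp add: frechet_derivative_works)
  qed
  ultimately show thesis by (rule that)
qed

text \<open>As \<open>hyp_laplace\<close> is a definite description quantified over frames, the existence of one
  frame is what makes its value unique.\<close>

lemma hyp_laplace_eq:
  assumes p: "p \<in> hyp_plane"
    and s: "\<And>e1 e2. hyp_frame p e1 e2 \<Longrightarrow> hyp_hess u p e1 e1 + hyp_hess u p e2 e2 = s"
  shows "hyp_laplace u p = s"
  unfolding hyp_laplace_def
  by (rule the_equality) (use s hyp_frame_exists[OF p] in metis)+

text \<open>By \<open>hyp_frame_trace\<close> the frame sum of any bilinear form \<open>H v \<bullet> w\<close> is its Minkowski trace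
  plus \<open>H p \<bullet> p\<close>, hence the same for all frames.\<close>

lemma hyp_laplace_frame:
  assumes U: "\<And>x. x \<in> hyp_plane \<Longrightarrow> (u has_derivative (\<lambda>h. g x \<bullet> h)) (at x within hyp_plane)"
    and H: "(g has_derivative H) (at p within hyp_plane)"
    and p: "p \<in> hyp_plane" and e: "hyp_frame p e1 e2"
  shows "hyp_laplace u p = hyp_hess u p e1 e1 + hyp_hess u p e2 e2"
proof -
  interpret bounded_linear H by (rule has_derivative_bounded_linear[OF H])
  have trace: "hyp_hess u p d1 d1 + hyp_hess u p d2 d2
      = (\<Sum>b\<in>Basis. mink b (H b) + (p \<bullet> b) * (p \<bullet> H b)) + 2 * (g p \<bullet> p)"
    if d: "hyp_frame p d1 d2" for d1 d2
  proof -
    have expand: "H d \<bullet> d = (\<Sum>b\<in>Basis. (d \<bullet> b) * (d \<bullet> H b))" for d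
    proof -
      have "H d = H (\<Sum>b\<in>Basis. (d \<bullet> b) *\<^sub>R b)" by (simp only: euclidean_representation)
      then have "H d = (\<Sum>b\<in>Basis. (d \<bullet> b) *\<^sub>R H b)" by (simp add: sum scaleR)
      then have "d \<bullet> H d = (\<Sum>b\<in>Basis. (d \<bullet> b) * (d \<bullet> H b))"
        by (simp only: inner_sum_right inner_scaleR_right)
      then show ?thesis by (simp add: inner_commute)
    qed
    have "H d1 \<bullet> d1 + H d2 \<bullet> d2 = (\<Sum>b\<in>Basis. mink b (H b) + (p \<bullet> b) * (p \<bullet> H b))"
      by (simp only: expand sum.distrib[symmetric] hyp_frame_trace[OF p d])
    then show ?thesis
      using d hyp_hess_eq[OF U H p] by (simp add: hyp_frame_def)
  qed
  show ?thesis
    by (rule hyp_laplace_eq[OF p]) (simp only: trace trace[OF e])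
qed

definition hyp_geodesic :: "real^3 \<Rightarrow> real^3 \<Rightarrow> real \<Rightarrow> real^3" where
  "hyp_geodesic p v t = cosh t *\<^sub>R p + sinh t *\<^sub>R v"

lemma hyp_geodesic_in_plane:
  assumes p: "p \<in> hyp_plane" and v: "v \<in> hyp_tangent p" "mink v v = 1"
  shows "hyp_geodesic p v t \<in> hyp_plane"
proof -
  let ?c = "hyp_geodesic p v"
  have m: "mink (?c t) (?c t) = -1"
  proof -
    have "mink (a *\<^sub>R p + b *\<^sub>R v) (a *\<^sub>R p + b *\<^sub>R v) = a\<^sup>2 * mink p p + 2 * a * b * mink p v + b\<^sup>2 * mink v v"
      for a b by (simp add: mink_def algebra_simps power2_eq_square)
    then show ?thesis using p v cosh_square_eq[of t]
      by (simp add: hyp_geodesic_def hyp_plane_def hyp_tangent_def)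
  qed
  \<comment> \<open>The two sheets of the hyperboloid are separated by the sign of the time component, which
     along the curve is at least \<open>cosh t * (p$1 - \<bar>v$1\<bar>)\<close>.\<close>
  have pp: "(p$1)\<^sup>2 = 1 + (p$2)\<^sup>2 + (p$3)\<^sup>2" "p$1 > 0" using p by (auto simp: hyp_plane_iff)
  have vv: "p$1 * v$1 = p$2 * v$2 + p$3 * v$3" "(v$2)\<^sup>2 + (v$3)\<^sup>2 = 1 + (v$1)\<^sup>2"
    using v by (auto simp: hyp_tangent_def mink_def power2_eq_square)
  have "(p$1 * v$1)\<^sup>2 + (p$2 * v$3 - p$3 * v$2)\<^sup>2 = ((p$2)\<^sup>2 + (p$3)\<^sup>2) * ((v$2)\<^sup>2 + (v$3)\<^sup>2)"
    unfolding vv(1) by (simp add: power2_eq_square algebra_simps)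
  also have "\<dots> = ((p$1)\<^sup>2 - 1) * (1 + (v$1)\<^sup>2)"
    using pp(1) vv(2) by simp
  finally have "(v$1)\<^sup>2 + 1 + (p$2 * v$3 - p$3 * v$2)\<^sup>2 = (p$1)\<^sup>2"
    by (simp add: power2_eq_square algebra_simps)
  then have "(v$1)\<^sup>2 < (p$1)\<^sup>2" by (smt (verit) zero_le_power2)
  then have "\<bar>v$1\<bar> < p$1" using pp(2) using power2_less_imp_less[of "\<bar>v$1\<bar>" "p$1"] by simp
  then have "\<bar>sinh t * v$1\<bar> < cosh t * p$1"
  proof -
    have "\<bar>sinh t\<bar> * \<bar>v$1\<bar> \<le> cosh t * \<bar>v$1\<bar>"
      using sinh_le_cosh_real[of t] sinh_le_cosh_real[of "- t"] by (intro mult_right_mono) auto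
    also have "\<dots> < cosh t * p$1"
      using \<open>\<bar>v$1\<bar> < p$1\<close> by simp
    finally show ?thesis by (simp add: abs_mult)
  qed
  then have "?c t $ 1 > 0" by (simp add: hyp_geodesic_def abs_less_iff)
  with m show ?thesis by (simp add: hyp_plane_def)
qed

lemma hyp_geodesic_derivative:
  "(hyp_geodesic p v has_vector_derivative sinh t *\<^sub>R p + cosh t *\<^sub>R v) (at t)"
  unfolding hyp_geodesic_def by (auto intro!: derivative_eq_intros)

lemma has_derivative_within_plane:
  assumes "hyp_plane \<subseteq> W" "\<And>x. x \<in> hyp_plane \<Longrightarrow> u x = U x"
    and "\<And>x. x \<in> W \<Longrightarrow> (U has_derivative D x) (at x)" and "x \<in> hyp_plane"
  shows "(u has_derivative D x) (at x within hyp_plane)"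
  by (rule has_derivative_transform[OF assms(4,2) has_derivative_at_withinI[OF assms(3)]])
     (use assms in auto)

text \<open>Along the unit speed geodesic \<open>c\<close>, where \<open>c'' = c\<close>, the second derivative of an ambient
  function is \<open>D\<^sup>2U(v, v) + DU(p)\<close>, which is the formula for the Hessian. Expressing the Hessian in
  this way reduces the maximum principle to one-variable calculus.\<close>

lemma hyp_hess_geodesic:
  assumes W: "open W" "hyp_plane \<subseteq> W" and uU: "\<And>x. x \<in> hyp_plane \<Longrightarrow> u x = U x"
    and g: "\<And>x. x \<in> W \<Longrightarrow> (U has_derivative (\<lambda>h. g x \<bullet> h)) (at x)"
    and H: "\<And>x. x \<in> W \<Longrightarrow> (g has_derivative H x) (at x)"
    and p: "p \<in> hyp_plane" and v: "v \<in> hyp_tangent p" "mink v v = 1"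
  obtains f' where "\<And>t. ((\<lambda>t. u (hyp_geodesic p v t)) has_real_derivative f' t) (at t)"
    and "(f' has_real_derivative hyp_hess u p v v) (at 0)"
proof -
  let ?c = "hyp_geodesic p v"
  let ?c' = "\<lambda>t. sinh t *\<^sub>R p + cosh t *\<^sub>R v"
  define f' where "f' t = g (?c t) \<bullet> ?c' t" for t
  have cW: "?c t \<in> W" for t using hyp_geodesic_in_plane[OF p v] W(2) by blast
  have dc: "(?c has_derivative (\<lambda>h. h *\<^sub>R ?c' t)) (at t)" for t
    using hyp_geodesic_derivative by (simp add: has_vector_derivative_def)
  have dc': "(?c' has_derivative (\<lambda>h. h *\<^sub>R ?c t)) (at t)" for t
    unfolding hyp_geodesic_def
    by (auto intro!: derivative_eq_intros simp: fun_eq_iff algebra_simps)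
  have "((\<lambda>t. U (?c t)) has_real_derivative f' t) (at t)" for t
    using has_derivative_compose[OF dc g[OF cW]]
    by (simp add: has_field_derivative_def f'_def mult_commute_abs)
  then have 1: "((\<lambda>t. u (?c t)) has_real_derivative f' t) (at t)" for t
    using uU[OF hyp_geodesic_in_plane[OF p v]] by simp
  have hs: "hyp_hess u p v v = H p v \<bullet> v + g p \<bullet> p"
  proof -
    show ?thesis
      using hyp_hess_eq[OF has_derivative_within_plane[OF W(2) uU g] has_derivative_at_withinI[OF H] p v(1) v(1)] p W v(2) by auto
  qed
  have "(f' has_derivative (\<lambda>h. g (?c 0) \<bullet> (h *\<^sub>R ?c 0) + H (?c 0) (h *\<^sub>R ?c' 0) \<bullet> ?c' 0)) (at 0)"
    unfolding f'_def
    by (rule has_derivative_inner has_derivative_compose[OF dc H[OF cW]] dc')+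
  then have "(f' has_real_derivative hyp_hess u p v v) (at 0)"
    using linear_cmul[OF has_derivative_linear[OF H]] p W(2)
    by (auto simp: has_field_derivative_def hs hyp_geodesic_def fun_eq_iff subset_iff algebra_simps elim!: has_derivative_eq_rhs)
  with 1 show thesis by (rule that)
qed

lemma second_derivative_at_max:
  fixes f f' :: "real \<Rightarrow> real"
  assumes f: "\<And>t. (f has_real_derivative f' t) (at t)" and f': "(f' has_real_derivative D) (at 0)"
    and max: "\<And>t. f t \<le> f 0"
  shows "D \<le> 0"
proof (rule ccontr)
  assume "\<not> D \<le> 0"
  then obtain d where d: "d > 0" "\<And>h. 0 < h \<Longrightarrow> h < d \<Longrightarrow> f' 0 < f' (0 + h)"
    using DERIV_pos_inc_right[OF f'] by force
  have f0: "f' 0 = 0"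
    by (rule DERIV_local_max[OF f, of 1]) (auto simp: max)
  obtain z where "0 < z" "z < d/2" "f (d/2) - f 0 = (d/2 - 0) * f' z"
    using MVT2[of 0 "d/2" f f'] f d(1) by auto
  with d(2)[of z] f0 d(1) max[of "d/2"] show False
    by (smt (verit) mult_pos_pos field_sum_of_halves)
qed

text \<open>The function \<open>1 / x$1\<close> is the barrier in the maximum principle. Its frame sum, computed from
  these second derivatives, is \<open>-2 / (p$1)^3\<close>.\<close>

lemma inv_geodesic_derivative:
  assumes p: "p \<in> hyp_plane" and v: "v \<in> hyp_tangent p" "mink v v = 1"
  obtains f' where "\<And>t. ((\<lambda>t. 1 / hyp_geodesic p v t $ 1) has_real_derivative f' t) (at t)"
    and "(f' has_real_derivative 2 * (v$1)\<^sup>2 / (p$1)^3 - 1 / p$1) (at 0)"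
proof -
  have c1: "hyp_geodesic p v t $ 1 = cosh t * p$1 + sinh t * v$1" for t
    by (simp add: hyp_geodesic_def)
  have pos: "cosh t * p$1 + sinh t * v$1 > 0" for t
    using hyp_geodesic_in_plane[OF p v, of t] by (simp add: hyp_plane_def c1)
  have p1: "p$1 > 0" using p by (simp add: hyp_plane_def)
  let ?f' = "\<lambda>t. - (sinh t * p$1 + cosh t * v$1) / (cosh t * p$1 + sinh t * v$1)\<^sup>2"
  have "((\<lambda>t. 1 / hyp_geodesic p v t $ 1) has_real_derivative ?f' t) (at t)" for t
    unfolding c1 using pos[of t]
    by (auto intro!: derivative_eq_intros simp: power2_eq_square)
  moreover have "(?f' has_real_derivative 2 * (v$1)\<^sup>2 / (p$1)^3 - 1 / p$1) (at 0)"
    using p1 by (auto intro!: derivative_eq_intros simp: field_simps eval_nat_numeral)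
  ultimately show thesis by (rule that)
qed

section \<open>The Klein model and the maximum principle\<close>

lemma hyp_plane_pos: "p \<in> hyp_plane \<Longrightarrow> p$1 > 0"
  by (simp add: hyp_plane_def)

definition klein_inv :: "complex \<Rightarrow> real^3" where
  "klein_inv \<eta> = (1 / sqrt (1 - (cmod \<eta>)\<^sup>2)) *\<^sub>R vector [1, Re \<eta>, Im \<eta>]"

lemma klein_inv_in_plane: assumes "\<eta> \<in> ball 0 1" shows "klein_inv \<eta> \<in> hyp_plane"
proof -
  have pos: "0 < 1 - (cmod \<eta>)\<^sup>2" using assms by (simp add: abs_square_less_1)
  have "1 - (cmod \<eta>)\<^sup>2 = 1 - (Re \<eta>)\<^sup>2 - (Im \<eta>)\<^sup>2" by (simp add: cmod_power2)
  then have "1 = (1 - (cmod \<eta>)\<^sup>2) + (Re \<eta>)\<^sup>2 + (Im \<eta>)\<^sup>2" by simp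
  then show ?thesis
    using pos by (simp add: klein_inv_def hyp_plane_iff power_divide field_simps
        del: cmod_power2)
qed

lemma klein_map_klein_inv: "\<eta> \<in> ball 0 1 \<Longrightarrow> klein_map (klein_inv \<eta>) = \<eta>"
  using abs_square_less_1[of "cmod \<eta>"] by (simp add: klein_map_def klein_inv_def complex_eq_iff)

lemma norm_klein_map:
  assumes "p \<in> hyp_plane"
  shows "1 - (cmod (klein_map p))\<^sup>2 = 1 / (p$1)\<^sup>2"
proof -
  have "(p$2)\<^sup>2 + (p$3)\<^sup>2 = (p$1)\<^sup>2 - 1"
    using assms by (simp add: hyp_plane_iff)
  then have "(p$1)\<^sup>2 * (1 - (cmod (klein_map p))\<^sup>2) = 1"
    using hyp_plane_pos[OF assms]
    by (simp add: klein_map_def cmod_power2 power_divide right_diff_distrib distrib_left)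
  then show ?thesis using hyp_plane_pos[OF assms] by (simp add: field_simps)
qed

lemma klein_inv_klein_map:
  assumes "p \<in> hyp_plane"
  shows "klein_inv (klein_map p) = p"
proof -
  have "p$1 > 0" using assms by (simp add: hyp_plane_iff)
  then show ?thesis
    unfolding klein_inv_def norm_klein_map[OF assms]
    by (simp add: klein_map_def real_sqrt_divide vec_eq_iff forall_3)
qed

lemma klein_map_in_ball: assumes "p \<in> hyp_plane" shows "klein_map p \<in> ball 0 1"
proof -
  have "0 < 1 - (cmod (klein_map p))\<^sup>2"
    unfolding norm_klein_map[OF assms] using hyp_plane_pos[OF assms] by simp
  then show ?thesis by (simp add: abs_square_less_1)
qed

lemma inv_klein_map: "\<eta> \<in> ball 0 1 \<Longrightarrow> inv_into hyp_plane klein_map \<eta> = klein_inv \<eta>"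
  by (rule inv_into_f_eq)
    (auto simp: klein_inv_in_plane klein_map_klein_inv intro: inj_on_inverseI klein_inv_klein_map)

lemma disk_fun_klein_map:
  assumes "p \<in> hyp_plane"
  shows "disk_fun u (klein_map p) = u p / p$1"
  using assms inv_klein_map[OF klein_map_in_ball[OF assms]] hyp_plane_pos[OF assms]
  by (simp add: disk_fun_def klein_inv_klein_map norm_klein_map real_sqrt_divide)

lemma disk_fun_eq: "\<eta> \<in> ball 0 1 \<Longrightarrow> disk_fun u \<eta> = sqrt (1 - (cmod \<eta>)\<^sup>2) * u (klein_inv \<eta>)"
  by (simp add: disk_fun_def inv_klein_map)

text \<open>The maximum principle. Suppose \<open>u1 > u2\<close> somewhere. The function \<open>x$1\<close> solves the equation
  and is positive, so the ratio \<open>(u1 - u2) / x$1\<close>, which is the difference of the disk functions,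
  should have no interior maximum. The degenerate case of the second derivative test is excluded by
  subtracting \<open>\<epsilon> / (x$1)\<^sup>2 = \<epsilon> * (1 - (cmod \<eta>)\<^sup>2)\<close>. The perturbation vanishes on the circle and turns
  the difference into a strict subsolution. If \<open>m > 0\<close> is the maximal value of the perturbed ratio,
  attained at \<open>q\<close>, then \<open>h = u1 - u2 - \<epsilon> / x$1 - m * x$1\<close> is nonpositive and vanishes at \<open>q\<close>, so its
  second derivatives along geodesics through \<open>q\<close> are nonpositive; but their sum over a frame is
  \<open>2 * \<epsilon> / q$1 + 2 * \<epsilon> / (q$1)^3 > 0\<close>.\<close>

lemma hyp_laplace_comparison:
  assumes u1: "hyp_smooth u1" "\<And>p. p \<in> hyp_plane \<Longrightarrow> hyp_laplace u1 p = 2 * u1 p" "has_boundary_values u1 \<phi>"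
    and u2: "hyp_smooth u2" "\<And>p. p \<in> hyp_plane \<Longrightarrow> hyp_laplace u2 p = 2 * u2 p" "has_boundary_values u2 \<phi>"
    and p: "p \<in> hyp_plane"
  shows "u1 p \<le> u2 p"
proof (rule ccontr)
  assume neg: "\<not> u1 p \<le> u2 p"
  obtain f1 where f1: "continuous_on (cball 0 1) f1" "\<And>\<eta>. \<eta> \<in> ball 0 1 \<Longrightarrow> f1 \<eta> = disk_fun u1 \<eta>"
    "\<And>z. z \<in> sphere 0 1 \<Longrightarrow> f1 z = \<phi> z"
    using u1(3) unfolding has_boundary_values_def by auto
  obtain f2 where f2: "continuous_on (cball 0 1) f2" "\<And>\<eta>. \<eta> \<in> ball 0 1 \<Longrightarrow> f2 \<eta> = disk_fun u2 \<eta>"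
    "\<And>z. z \<in> sphere 0 1 \<Longrightarrow> f2 z = \<phi> z"
    using u2(3) unfolding has_boundary_values_def by auto
  have p1: "p$1 > 0" using p by (simp add: hyp_plane_iff)
  \<comment> \<open>So small that the perturbed ratio is still positive at \<open>klein_map p\<close>.\<close>
  define \<epsilon> where "\<epsilon> = (u1 p - u2 p) * p$1 / 2"
  have eps: "\<epsilon> > 0" using neg p1 by (simp add: \<epsilon>_def)
  define F where "F \<eta> = f1 \<eta> - f2 \<eta> - \<epsilon> * (1 - (cmod \<eta>)\<^sup>2)" for \<eta>
  have F_klein: "F (klein_map q) = (u1 q - u2 q) / q$1 - \<epsilon> / (q$1)\<^sup>2" if "q \<in> hyp_plane" for q
    using klein_map_in_ball[OF that] norm_klein_map[OF that]
    by (simp add: F_def f1 f2 disk_fun_klein_map[OF that] diff_divide_distrib)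
  have "continuous_on (cball 0 1) F"
    unfolding F_def by (intro continuous_intros f1 f2)
  then obtain \<eta>0 where \<eta>0: "\<eta>0 \<in> cball 0 1" "\<And>\<eta>. \<eta> \<in> cball 0 1 \<Longrightarrow> F \<eta> \<le> F \<eta>0"
    using continuous_attains_sup[of "cball 0 1" F] by auto
  define m where "m = F \<eta>0"
  have "F (klein_map p) > 0"
    using neg p1 by (simp add: F_klein[OF p] \<epsilon>_def power2_eq_square field_simps)
  moreover have "klein_map p \<in> cball 0 1"
    using klein_map_in_ball[OF p] by simp
  ultimately have m: "m > 0" using \<eta>0(2)[of "klein_map p"] by (simp add: m_def)
  have "\<eta>0 \<in> ball 0 1"
  proof (rule ccontr)
    assume "\<eta>0 \<notin> ball 0 1"
    then have "\<eta>0 \<in> sphere 0 1" using \<eta>0(1) by simp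
    then have "F \<eta>0 = 0" using f1(3) f2(3) by (simp add: F_def)
    then show False using m by (simp add: m_def)
  qed
  define q where "q = klein_inv \<eta>0"
  have q: "q \<in> hyp_plane" and kq: "klein_map q = \<eta>0"
    using \<open>\<eta>0 \<in> ball 0 1\<close> by (simp_all add: q_def klein_inv_in_plane klein_map_klein_inv)
  define h where "h x = u1 x - u2 x - \<epsilon> * (1 / x$1) - m * x$1" for x
  have h_F: "h x = x$1 * (F (klein_map x) - m)" if "x \<in> hyp_plane" for x
    using hyp_plane_pos[OF that] by (simp add: h_def F_klein[OF that] field_simps power2_eq_square)
  have h_le: "h x \<le> 0" if "x \<in> hyp_plane" for x
  proof -
    have "klein_map x \<in> cball 0 1" using klein_map_in_ball[OF that] by simp
    then have "F (klein_map x) - m \<le> 0" using \<eta>0(2) by (simp add: m_def)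
    then show ?thesis using that by (simp add: h_F hyp_plane_iff mult_le_0_iff)
  qed
  have h_q: "h q = 0" using q by (simp add: h_F kq m_def)
  obtain W1 U1 where 1: "open W1" "hyp_plane \<subseteq> W1" "\<And>k. Ck_on k U1 W1" "\<And>x. x \<in> hyp_plane \<Longrightarrow> u1 x = U1 x"
    using u1(1) unfolding hyp_smooth_def by blast
  obtain g1 H1 where gH1: "\<And>x. x \<in> W1 \<Longrightarrow> (U1 has_derivative (\<lambda>h. g1 x \<bullet> h)) (at x)"
    "\<And>x. x \<in> W1 \<Longrightarrow> (g1 has_derivative H1 x) (at x)"
    using Ck_on_gradient[OF 1(3) 1(1)] by blast
  obtain W2 U2 where 2: "open W2" "hyp_plane \<subseteq> W2" "\<And>k. Ck_on k U2 W2" "\<And>x. x \<in> hyp_plane \<Longrightarrow> u2 x = U2 x"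
    using u2(1) unfolding hyp_smooth_def by blast
  obtain g2 H2 where gH2: "\<And>x. x \<in> W2 \<Longrightarrow> (U2 has_derivative (\<lambda>h. g2 x \<bullet> h)) (at x)"
    "\<And>x. x \<in> W2 \<Longrightarrow> (g2 has_derivative H2 x) (at x)"
    using Ck_on_gradient[OF 2(3) 2(1)] by blast
  have second: "hyp_hess u1 q v v - hyp_hess u2 q v v - \<epsilon> * (2 * (v$1)\<^sup>2 / (q$1)^3 - 1 / q$1) - m * q$1 \<le> 0"
    if v: "v \<in> hyp_tangent q" "mink v v = 1" for v
  proof -
    obtain f1' where f1': "\<And>t. ((\<lambda>t. u1 (hyp_geodesic q v t)) has_real_derivative f1' t) (at t)"
      "(f1' has_real_derivative hyp_hess u1 q v v) (at 0)"
      using hyp_hess_geodesic[OF 1(1,2,4) gH1 q v] by blast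
    obtain f2' where f2': "\<And>t. ((\<lambda>t. u2 (hyp_geodesic q v t)) has_real_derivative f2' t) (at t)"
      "(f2' has_real_derivative hyp_hess u2 q v v) (at 0)"
      using hyp_hess_geodesic[OF 2(1,2,4) gH2 q v] by blast
    obtain f3' where f3': "\<And>t. ((\<lambda>t. 1 / hyp_geodesic q v t $ 1) has_real_derivative f3' t) (at t)"
      "(f3' has_real_derivative 2 * (v$1)\<^sup>2 / (q$1)^3 - 1 / q$1) (at 0)"
      using inv_geodesic_derivative[OF q v] by blast
    have c1: "((\<lambda>t. hyp_geodesic q v t $ 1) has_real_derivative sinh t * q$1 + cosh t * v$1) (at t)" for t
      unfolding hyp_geodesic_def by (auto intro!: derivative_eq_intros)
    have c2: "((\<lambda>t. sinh t * q$1 + cosh t * v$1) has_real_derivative q$1) (at 0)"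
      by (auto intro!: derivative_eq_intros)
    have "((\<lambda>t. h (hyp_geodesic q v t)) has_real_derivative
        f1' t - f2' t - \<epsilon> * f3' t - m * (sinh t * q$1 + cosh t * v$1)) (at t)" for t
      unfolding h_def by (intro DERIV_diff DERIV_cmult f1' f2' f3' c1)
    moreover have "((\<lambda>t. f1' t - f2' t - \<epsilon> * f3' t - m * (sinh t * q$1 + cosh t * v$1)) has_real_derivative
       hyp_hess u1 q v v - hyp_hess u2 q v v - \<epsilon> * (2 * (v$1)\<^sup>2 / (q$1)^3 - 1 / q$1) - m * q$1) (at 0)"
      by (intro DERIV_diff DERIV_cmult f1' f2' f3' c2)
    ultimately show ?thesis
      by (rule second_derivative_at_max)
         (use h_le hyp_geodesic_in_plane[OF q v] h_q in \<open>simp add: hyp_geodesic_def\<close>)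
  qed
  obtain e1 e2 where e: "hyp_frame q e1 e2" using hyp_frame_exists[OF q] .
  have L1: "hyp_laplace u1 q = hyp_hess u1 q e1 e1 + hyp_hess u1 q e2 e2"
    by (rule hyp_laplace_frame[OF has_derivative_within_plane[OF 1(2,4) gH1(1)]
          has_derivative_at_withinI[OF gH1(2)] q e]) (use q 1(2) in auto)
  have L2: "hyp_laplace u2 q = hyp_hess u2 q e1 e1 + hyp_hess u2 q e2 e2"
    by (rule hyp_laplace_frame[OF has_derivative_within_plane[OF 2(2,4) gH2(1)]
          has_derivative_at_withinI[OF gH2(2)] q e]) (use q 2(2) in auto)
  have q1: "q$1 > 0" by (rule hyp_plane_pos[OF q])
  have trace: "(e1$1)\<^sup>2 + (e2$1)\<^sup>2 = (q$1)\<^sup>2 - 1"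
  proof -
    have "mink (axis 1 1) (axis 1 1) = -1" by (simp add: mink_def axis_def)
    then show ?thesis
      using hyp_frame_trace[OF q e, of "axis 1 1" "axis 1 1"]
      by (simp add: inner_axis power2_eq_square)
  qed
  have "hyp_laplace u1 q - hyp_laplace u2 q
      - \<epsilon> * (2 * ((e1$1)\<^sup>2 + (e2$1)\<^sup>2) / (q$1)^3 - 2 / q$1) - 2 * (m * q$1) \<le> 0"
    using second[of e1] second[of e2] e
    by (simp add: L1 L2 hyp_frame_def algebra_simps divide_inverse)
  also have "2 * ((e1$1)\<^sup>2 + (e2$1)\<^sup>2) / (q$1)^3 - 2 / q$1 = - 2 / (q$1)^3"
    unfolding trace using q1 by (simp add: field_simps eval_nat_numeral)
  also have "hyp_laplace u1 q - hyp_laplace u2 q = 2 * (\<epsilon> / q$1 + m * q$1)"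
    using h_q by (simp add: u1(2)[OF q] u2(2)[OF q] h_def)
  finally have "2 * \<epsilon> / q$1 + 2 * \<epsilon> / (q$1)^3 \<le> 0" by (simp add: algebra_simps)
  then show False using eps q1 by (smt (verit) divide_pos_pos zero_less_power)
qed

section \<open>Superpositions of powers of null coordinates\<close>

text \<open>The boundary point \<open>cis \<theta>\<close> as a null vector \<open>(1, cos \<theta>, sin \<theta>)\<close> of the light cone, lowered and
  with the sign for which \<open>x \<bullet> null_covector \<theta> = - mink x (1, cos \<theta>, sin \<theta>)\<close> is positive on the
  hyperboloid.\<close>

definition null_covector :: "real \<Rightarrow> real^3" where
  "null_covector \<theta> = axis 1 1 - cos \<theta> *\<^sub>R axis 2 1 - sin \<theta> *\<^sub>R axis 3 1"

definition future_cone :: "(real^3) set" where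
  "future_cone = {x. cmod (Complex (x$2) (x$3)) < x$1}"

text \<open>For \<open>n = 2\<close> this is an explicit solution of the equation \<open>\<Delta>u = 2u\<close> on the hyperboloid. It is
  defined on the whole future cone, vector valued and for all \<open>n\<close>, because differentiation leads
  from exponent \<open>n\<close> to exponent \<open>Suc n\<close> with a density multiplied by the null covector.\<close>

definition wave :: "nat \<Rightarrow> (real \<Rightarrow> 'b::euclidean_space) \<Rightarrow> real^3 \<Rightarrow> 'b" where
  "wave n \<Psi> x = integral {0..2*pi} (\<lambda>\<theta>. (1 / (x \<bullet> null_covector \<theta>) ^ n) *\<^sub>R \<Psi> \<theta>)"

lemma inner_null_covector: "x \<bullet> null_covector \<theta> = x$1 - x$2 * cos \<theta> - x$3 * sin \<theta>"
  by (simp add: null_covector_def inner_diff_right inner_axis)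

lemma mink_null_covector: "mink (null_covector \<theta>) (null_covector \<theta>) = 0"
  using sin_cos_squared_add[of \<theta>]
  by (simp add: mink_def null_covector_def axis_def power2_eq_square)

lemma continuous_on_null_covector [continuous_intros]:
  fixes f :: "'a::t2_space \<Rightarrow> real"
  shows "continuous_on S f \<Longrightarrow> continuous_on S (\<lambda>x. null_covector (f x))"
  unfolding null_covector_def by (intro continuous_intros)

lemma open_future_cone: "open future_cone"
  unfolding future_cone_def complex_norm complex.sel
  by (intro open_Collect_less continuous_intros)

lemma convex_future_cone: "convex future_cone"
proof (rule convexI)
  fix x y and u v :: real assume xy: "x \<in> future_cone" "y \<in> future_cone" and uv: "0 \<le> u" "0 \<le> v" "u + v = 1"
  have "cmod (Complex ((u *\<^sub>R x + v *\<^sub>R y)$2) ((u *\<^sub>R x + v *\<^sub>R y)$3))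
      = cmod (u *\<^sub>R Complex (x$2) (x$3) + v *\<^sub>R Complex (y$2) (y$3))"
    by (intro arg_cong[of _ _ cmod]) (simp add: complex_eq_iff)
  also have "\<dots> \<le> u * cmod (Complex (x$2) (x$3)) + v * cmod (Complex (y$2) (y$3))"
    using uv norm_triangle_ineq[of "u *\<^sub>R Complex (x$2) (x$3)" "v *\<^sub>R Complex (y$2) (y$3)"] by simp
  also have "\<dots> < u * x$1 + v * y$1"
  proof (cases "u = 0")
    case False
    then have "u * cmod (Complex (x$2) (x$3)) < u * x$1" "v * cmod (Complex (y$2) (y$3)) \<le> v * y$1"
      using xy uv by (auto simp: future_cone_def intro!: mult_left_mono)
    then show ?thesis by linarith
  qed (use xy uv in \<open>simp add: future_cone_def\<close>)
  finally show "u *\<^sub>R x + v *\<^sub>R y \<in> future_cone" by (simp add: future_cone_def)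
qed

lemma hyp_plane_subset_future_cone: "hyp_plane \<subseteq> future_cone"
proof
  fix x assume x: "x \<in> hyp_plane"
  then have "(cmod (Complex (x$2) (x$3)))\<^sup>2 < (x$1)\<^sup>2" by (simp add: hyp_plane_iff cmod_power2)
  then show "x \<in> future_cone"
    using power2_less_imp_less[of _ "x$1"] hyp_plane_pos[OF x] by (simp add: future_cone_def)
qed

lemma null_covector_pos:
  assumes "x \<in> future_cone" shows "x \<bullet> null_covector \<theta> > 0"
proof -
  have "x$2 * cos \<theta> + x$3 * sin \<theta> = Re (Complex (x$2) (x$3) * cis (- \<theta>))" by simp
  also have "\<dots> \<le> cmod (Complex (x$2) (x$3))"
    using complex_Re_le_cmod[of "Complex (x$2) (x$3) * cis (- \<theta>)"] by (simp only: norm_mult norm_cis mult_1_right)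
  finally show ?thesis using assms by (simp add: inner_null_covector future_cone_def)
qed

lemma continuous_on_wave_integrand [continuous_intros]:
  fixes S :: "real set" and \<Psi> :: "real \<Rightarrow> 'b::euclidean_space"
  assumes "x \<in> future_cone" "continuous_on S \<Psi>"
  shows "continuous_on S (\<lambda>\<theta>. (1 / (x \<bullet> null_covector \<theta>) ^ n) *\<^sub>R \<Psi> \<theta>)"
  using null_covector_pos[OF assms(1)] assms(2)
  by (intro continuous_intros) (auto simp: less_imp_neq[THEN not_sym])

lemma wave_integrable:
  fixes \<Psi> :: "real \<Rightarrow> 'b::euclidean_space"
  assumes "x \<in> future_cone" "continuous_on {0..2*pi} \<Psi>"
  shows "(\<lambda>\<theta>. (1 / (x \<bullet> null_covector \<theta>) ^ n) *\<^sub>R \<Psi> \<theta>) integrable_on {0..2*pi}"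
  by (intro integrable_continuous_interval continuous_on_wave_integrand assms)

lemma wave_linear:
  assumes T: "bounded_linear T" and "x \<in> future_cone" "continuous_on {0..2*pi} \<Psi>"
  shows "T (wave n \<Psi> x) = wave n (\<lambda>\<theta>. T (\<Psi> \<theta>)) x"
  using integral_linear[OF wave_integrable[OF assms(2,3)] T, of n]
  by (simp add: wave_def o_def linear_cmul[OF bounded_linear.linear[OF T]])

lemma wave_add:
  assumes "x \<in> future_cone" "continuous_on {0..2*pi} \<Phi>" "continuous_on {0..2*pi} \<Psi>"
  shows "wave n (\<lambda>\<theta>. \<Phi> \<theta> + \<Psi> \<theta>) x = wave n \<Phi> x + wave n \<Psi> x"
  unfolding wave_def scaleR_add_right
  by (intro integral_add wave_integrable assms)

lemma wave_lower:
  assumes "x \<in> future_cone"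
  shows "wave (n + k) (\<lambda>\<theta>. (x \<bullet> null_covector \<theta>) ^ k *\<^sub>R \<Psi> \<theta>) x = wave n \<Psi> x"
  unfolding wave_def
  by (rule integral_cong) (use null_covector_pos[OF assms] in \<open>simp add: power_add less_imp_neq[THEN not_sym]\<close>)

lemma wave_has_derivative:
  assumes x: "x \<in> future_cone" and \<Psi>: "continuous_on {0..2*pi} \<Psi>"
  shows "(wave n \<Psi> has_derivative (\<lambda>h. wave (Suc n) (\<lambda>\<theta>. (- real n * (h \<bullet> null_covector \<theta>)) *\<^sub>R \<Psi> \<theta>) x)) (at x)"
proof -
  let ?l = null_covector
  define c where "c y \<theta> = - real n / (y \<bullet> ?l \<theta>) ^ Suc n" for y \<theta>
  define F where "F y \<theta> = blinfun_scaleR_left (\<Psi> \<theta>) o\<^sub>L (c y \<theta> *\<^sub>R blinfun_inner_left (?l \<theta>))" for y \<theta>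
  have ne: "y \<bullet> ?l \<theta> \<noteq> 0" if "y \<in> future_cone" for y \<theta>
    using null_covector_pos[OF that, of \<theta>] by simp
  have F: "blinfun_apply (F y \<theta>) h = (c y \<theta> * (h \<bullet> ?l \<theta>)) *\<^sub>R \<Psi> \<theta>" for y \<theta> h
    by (simp add: F_def blinfun.scaleR_left)
  have contF: "continuous_on (future_cone \<times> cbox 0 (2*pi)) (\<lambda>(y, \<theta>). F y \<theta>)"
    unfolding F_def c_def split_beta
    by (intro continuous_intros bounded_linear.continuous_on[OF bounded_linear_blinfun_scaleR_left]
        bounded_linear.continuous_on[OF bounded_linear_blinfun_inner_left]
        bounded_bilinear.continuous_on[OF bounded_bilinear_blinfun_compose]
        continuous_on_compose2[OF \<Psi>]) (auto simp: ne)
  have "((\<lambda>y. integral (cbox 0 (2*pi)) (\<lambda>\<theta>. (1 / (y \<bullet> ?l \<theta>) ^ n) *\<^sub>R \<Psi> \<theta>))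
      has_derivative integral (cbox 0 (2*pi)) (F x)) (at x within future_cone)"
  proof (rule leibniz_rule[OF _ _ contF x convex_future_cone])
    fix y \<theta> assume y: "y \<in> future_cone"
    have "((\<lambda>y. (1 / (y \<bullet> ?l \<theta>) ^ n)) has_derivative (\<lambda>h. c y \<theta> * (h \<bullet> ?l \<theta>))) (at y within future_cone)"
    proof -
      have "((\<lambda>s. inverse s ^ n) has_real_derivative - real n / (y \<bullet> ?l \<theta>) ^ Suc n) (at (y \<bullet> ?l \<theta>))"
        by (rule DERIV_cong[OF DERIV_power[OF DERIV_inverse[OF ne[OF y]]]])
           (cases n; simp add: divide_inverse power_inverse algebra_simps)
      from has_derivative_compose[OF bounded_linear.has_derivative[OF bounded_linear_inner_left has_derivative_ident]
          this[unfolded has_field_derivative_def]]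
      show ?thesis by (simp add: c_def divide_inverse power_inverse)
    qed
    from has_derivative_scaleR_left[OF this, of "\<Psi> \<theta>"]
    show "((\<lambda>y. (1 / (y \<bullet> ?l \<theta>) ^ n) *\<^sub>R \<Psi> \<theta>) has_derivative blinfun_apply (F y \<theta>)) (at y within future_cone)"
      unfolding F[of y \<theta>, THEN ext] .
  next
    fix y assume "y \<in> future_cone"
    then show "(\<lambda>\<theta>. (1 / (y \<bullet> ?l \<theta>) ^ n) *\<^sub>R \<Psi> \<theta>) integrable_on cbox 0 (2*pi)"
      using wave_integrable[OF _ \<Psi>] by simp
  qed
  then have D: "(wave n \<Psi> has_derivative integral (cbox 0 (2*pi)) (F x)) (at x)"
    using at_within_open[OF x open_future_cone] by (simp add: wave_def[abs_def])
  have int: "F x integrable_on {0..2*pi}"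
    by (rule integrable_continuous_interval)
       (use continuous_on_compose2[OF contF, of "{0..2*pi}" "\<lambda>\<theta>. (x, \<theta>)"] x
         in \<open>simp add: continuous_on_Pair image_subset_iff\<close>)
  have "blinfun_apply (integral {0..2*pi} (F x)) h
      = wave (Suc n) (\<lambda>\<theta>. (- real n * (h \<bullet> ?l \<theta>)) *\<^sub>R \<Psi> \<theta>) x" for h
    using integral_linear[OF int bounded_linear_apply_blinfun[of h]]
    by (simp add: o_def F wave_def c_def mult_ac divide_inverse)
  from D[unfolded cbox_interval this[THEN ext]] show ?thesis .
qed

lemma Ck_on_cong:
  assumes S: "open S" and fg: "\<And>x. x \<in> S \<Longrightarrow> f x = g x"
  shows "Ck_on k f S \<longleftrightarrow> Ck_on k g S"
  using fg
proof (induction k arbitrary: f g)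
  case 0
  then show ?case by (auto cong: continuous_on_cong)
next
  case (Suc k)
  have D: "(f has_derivative D) (at x) \<longleftrightarrow> (g has_derivative D) (at x)" if "x \<in> S" for x D
    using has_derivative_transform_within_open[OF _ S that, of f D UNIV g]
     has_derivative_transform_within_open[OF _ S that, of g D UNIV f] Suc.prems by auto
  then have fd: "frechet_derivative f (at x) = frechet_derivative g (at x)" if "x \<in> S" for x
    using that by (simp add: frechet_derivative_def)
  have "f differentiable (at x) \<longleftrightarrow> g differentiable (at x)" if "x \<in> S" for x
    using D[OF that] by (simp add: differentiable_def)
  moreover have "Ck_on k (\<lambda>x. frechet_derivative f (at x) b) S \<longleftrightarrow> Ck_on k (\<lambda>x. frechet_derivative g (at x) b) S" for b
    by (rule Suc.IH) (simp add: fd)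
  ultimately show ?case by simp
qed

text \<open>The directional derivatives of a superposition are superpositions with continuous density
  again, so the induction closes once the exponent and the density are arbitrary.\<close>

lemma Ck_on_wave:
  fixes \<psi> :: "real \<Rightarrow> real"
  assumes "continuous_on {0..2*pi} \<psi>"
  shows "Ck_on k (wave n \<psi>) future_cone"
  using assms
proof (induction k arbitrary: n \<psi>)
  case 0
  then have "continuous_on future_cone (wave n \<psi>)"
    using wave_has_derivative has_derivative_continuous
    by (intro continuous_at_imp_continuous_on ballI) blast
  then show ?case by simp
next
  case (Suc k)
  note D = wave_has_derivative[OF _ Suc.prems, of _ n]
  have "Ck_on k (\<lambda>x. frechet_derivative (wave n \<psi>) (at x) b) future_cone" for b
  proof (subst Ck_on_cong[OF open_future_cone])
    show "frechet_derivative (wave n \<psi>) (at x) b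
        = wave (Suc n) (\<lambda>\<theta>. (- real n * (b \<bullet> null_covector \<theta>)) *\<^sub>R \<psi> \<theta>) x" if "x \<in> future_cone" for x
      using fun_cong[OF frechet_derivative_at[OF D[OF that]], of b] by simp
    show "Ck_on k (wave (Suc n) (\<lambda>\<theta>. (- real n * (b \<bullet> null_covector \<theta>)) *\<^sub>R \<psi> \<theta>)) future_cone"
      by (intro Suc.IH continuous_intros Suc.prems)
  qed
  moreover have "wave n \<psi> differentiable (at x)" if "x \<in> future_cone" for x
    using D[OF that] by (rule differentiableI)
  ultimately show ?case by simp
qed

lemma wave_gradient:
  fixes \<psi> :: "real \<Rightarrow> real"
  assumes x: "x \<in> future_cone" and \<psi>: "continuous_on {0..2*pi} \<psi>"
  shows "(wave 2 \<psi> has_derivative (\<lambda>h. wave 3 (\<lambda>\<theta>. (- 2 * \<psi> \<theta>) *\<^sub>R null_covector \<theta>) x \<bullet> h)) (at x)"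
proof -
  have "wave 3 (\<lambda>\<theta>. (- 2 * \<psi> \<theta>) *\<^sub>R null_covector \<theta>) x \<bullet> h
     = wave (Suc 2) (\<lambda>\<theta>. (- real 2 * (h \<bullet> null_covector \<theta>)) *\<^sub>R \<psi> \<theta>) x" for h
  proof -
    have "continuous_on {0..2*pi} (\<lambda>\<theta>. (- 2 * \<psi> \<theta>) *\<^sub>R null_covector \<theta>)"
      by (intro continuous_intros \<psi>)
    from wave_linear[OF bounded_linear_inner_left[of h] x this, of 3] show ?thesis
      by (simp add: inner_commute mult_ac)
  qed
  then show ?thesis using wave_has_derivative[OF assms, of 2] by (simp only: numeral_3_eq_3[symmetric] numeral_2_eq_2[symmetric])
qed

text \<open>Here \<open>D\<^sup>2U(v, v)\<close> has density \<open>6 * (v \<bullet> l)\<^sup>2 / (p \<bullet> l)^4\<close>. As \<open>l\<close> is null, its sum over a frame is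
  \<open>6 / (p \<bullet> l)\<^sup>2\<close>, that is, \<open>6 * U p\<close>; homogeneity of degree -2 gives \<open>DU(p) = -2 * U p\<close>, which the Hessian
  formula counts twice. In total \<open>6 - 4 = 2\<close>.\<close>

lemma hyp_laplace_wave:
  fixes \<psi> :: "real \<Rightarrow> real"
  assumes p: "p \<in> hyp_plane" and \<psi>: "continuous_on {0..2*pi} \<psi>"
    and u: "\<And>x. x \<in> hyp_plane \<Longrightarrow> u x = wave 2 \<psi> x"
  shows "hyp_laplace u p = 2 * u p"
proof (rule hyp_laplace_eq[OF p])
  fix e1 e2 assume e: "hyp_frame p e1 e2"
  let ?l = null_covector
  define g where "g = wave 3 (\<lambda>\<theta>. (- 2 * \<psi> \<theta>) *\<^sub>R ?l \<theta>)"
  define H where "H h = wave 4 (\<lambda>\<theta>. (6 * (h \<bullet> ?l \<theta>) * \<psi> \<theta>) *\<^sub>R ?l \<theta>) p" for h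
  have pc: "p \<in> future_cone" using p hyp_plane_subset_future_cone by blast
  have cont: "continuous_on {0..2*pi} (\<lambda>\<theta>. (- 2 * \<psi> \<theta>) *\<^sub>R ?l \<theta>)"
    by (intro continuous_intros \<psi>)
  have U: "(u has_derivative (\<lambda>h. g x \<bullet> h)) (at x within hyp_plane)" if "x \<in> hyp_plane" for x
  proof -
    have "(wave 2 \<psi> has_derivative (\<lambda>h. g y \<bullet> h)) (at y)" if "y \<in> future_cone" for y
      unfolding g_def by (rule wave_gradient[OF that \<psi>])
    from has_derivative_within_plane[OF hyp_plane_subset_future_cone u this that] show ?thesis .
  qed
  have "(g has_derivative H) (at p within hyp_plane)"
  proof -
    have "(- real 3 * a) *\<^sub>R (- 2 * b) *\<^sub>R v = (6 * a * b) *\<^sub>R v" for a b and v :: "real^3"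
      by simp
    moreover have "Suc 3 = 4" by simp
    ultimately have "(g has_derivative H) (at p)"
      using wave_has_derivative[OF pc cont, of 3] unfolding g_def H_def[abs_def] by (simp only:)
    then show ?thesis by (rule has_derivative_at_withinI)
  qed
  note hess = hyp_hess_eq[OF U this p]
  have HH: "H h \<bullet> h = wave 4 (\<lambda>\<theta>. 6 * \<psi> \<theta> * (h \<bullet> ?l \<theta>)\<^sup>2) p" for h
  proof -
    have "continuous_on {0..2*pi} (\<lambda>\<theta>. (6 * (h \<bullet> ?l \<theta>) * \<psi> \<theta>) *\<^sub>R ?l \<theta>)"
      by (intro continuous_intros \<psi>)
    then have "H h \<bullet> h = wave 4 (\<lambda>\<theta>. ((6 * (h \<bullet> ?l \<theta>) * \<psi> \<theta>) *\<^sub>R ?l \<theta>) \<bullet> h) p"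
      unfolding H_def by (rule wave_linear[OF bounded_linear_inner_left pc])
    moreover have "(\<lambda>\<theta>. ((6 * (h \<bullet> ?l \<theta>) * \<psi> \<theta>) *\<^sub>R ?l \<theta>) \<bullet> h) = (\<lambda>\<theta>. 6 * \<psi> \<theta> * (h \<bullet> ?l \<theta>)\<^sup>2)"
      by (simp add: fun_eq_iff inner_commute[of "?l _" h] power2_eq_square)
    ultimately show ?thesis by (simp only:)
  qed
  have "H e1 \<bullet> e1 + H e2 \<bullet> e2 = wave 4 (\<lambda>\<theta>. 6 * \<psi> \<theta> * (e1 \<bullet> ?l \<theta>)\<^sup>2 + 6 * \<psi> \<theta> * (e2 \<bullet> ?l \<theta>)\<^sup>2) p"
    unfolding HH by (subst wave_add[OF pc]) (auto intro!: continuous_intros \<psi>)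
  also have "\<dots> = wave (2 + 2) (\<lambda>\<theta>. (p \<bullet> ?l \<theta>)\<^sup>2 *\<^sub>R (6 * \<psi> \<theta>)) p"
  proof -
    have "6 * \<psi> \<theta> * (e1 \<bullet> ?l \<theta>)\<^sup>2 + 6 * \<psi> \<theta> * (e2 \<bullet> ?l \<theta>)\<^sup>2 = (p \<bullet> ?l \<theta>)\<^sup>2 *\<^sub>R (6 * \<psi> \<theta>)" for \<theta>
      using hyp_frame_trace[OF p e, of "?l \<theta>" "?l \<theta>"]
      by (simp add: mink_null_covector power2_eq_square distrib_left[symmetric])
    then show ?thesis by simp
  qed
  also have "\<dots> = 6 * wave 2 \<psi> p"
    unfolding wave_lower[OF pc] using wave_linear[OF bounded_linear_mult_right pc \<psi>, of 6 2] by simp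
  finally have tr: "H e1 \<bullet> e1 + H e2 \<bullet> e2 = 6 * wave 2 \<psi> p" .
  have "g p \<bullet> p = wave (2 + 1) (\<lambda>\<theta>. (p \<bullet> ?l \<theta>)^1 *\<^sub>R (- 2 * \<psi> \<theta>)) p"
    unfolding g_def
    by (subst wave_linear[OF bounded_linear_inner_left pc cont])
       (simp add: inner_commute[of "?l _" p] mult.commute)
  also have "\<dots> = - 2 * wave 2 \<psi> p"
    unfolding wave_lower[OF pc] using wave_linear[OF bounded_linear_mult_right pc \<psi>, of "-2" 2] by simp
  finally show "hyp_hess u p e1 e1 + hyp_hess u p e2 e2 = 2 * u p"
    using e tr by (simp add: hess hyp_frame_def u[OF p])
qed

section \<open>The Poincare model and the first harmonics\<close>

definition poincare_inv :: "complex \<Rightarrow> real^3" where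
  "poincare_inv z = (1 / (1 - (cmod z)\<^sup>2)) *\<^sub>R vector [1 + (cmod z)\<^sup>2, 2 * Re z, 2 * Im z]"

lemma poincare_inv_in_plane: assumes "z \<in> ball 0 1" shows "poincare_inv z \<in> hyp_plane"
proof -
  define d where "d = 1 - (cmod z)\<^sup>2"
  have d: "0 < d" using assms by (simp add: abs_square_less_1 d_def)
  have n: "(cmod z)\<^sup>2 = (Re z)\<^sup>2 + (Im z)\<^sup>2" by (rule cmod_power2)
  have "(1 + (cmod z)\<^sup>2)\<^sup>2 = d\<^sup>2 + (2 * Re z)\<^sup>2 + (2 * Im z)\<^sup>2"
    unfolding d_def n by (simp add: power2_eq_square algebra_simps)
  moreover have "0 < 1 + (cmod z)\<^sup>2" by (smt (verit) zero_le_power2)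
  ultimately show ?thesis
    using d by (simp add: poincare_inv_def d_def[symmetric] hyp_plane_iff power_divide field_simps)
qed

lemma poincare_map_poincare_inv: assumes "z \<in> ball 0 1" shows "poincare_map (poincare_inv z) = z"
proof -
  have "0 < 1 - (cmod z)\<^sup>2" using assms by (simp add: abs_square_less_1)
  then show ?thesis by (simp add: poincare_map_def poincare_inv_def complex_eq_iff field_simps)
qed

lemma norm_poincare_map:
  assumes "p \<in> hyp_plane"
  shows "(cmod (poincare_map p))\<^sup>2 = (p$1 - 1) / (p$1 + 1)"
proof -
  have "(p$2)\<^sup>2 + (p$3)\<^sup>2 = (p$1 - 1) * (p$1 + 1)"
    using assms by (simp add: hyp_plane_iff power2_eq_square algebra_simps)
  then have "(cmod (poincare_map p))\<^sup>2 = (p$1 - 1) * (p$1 + 1) / (p$1 + 1)\<^sup>2"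
    by (simp add: poincare_map_def cmod_power2 power_divide add_divide_distrib[symmetric] add.commute)
  then show ?thesis using hyp_plane_pos[OF assms] by (simp add: power2_eq_square)
qed

lemma poincare_map_in_ball: assumes "p \<in> hyp_plane" shows "poincare_map p \<in> ball 0 1"
proof -
  have "(cmod (poincare_map p))\<^sup>2 < 1"
    unfolding norm_poincare_map[OF assms] using hyp_plane_pos[OF assms] by simp
  then show ?thesis by (simp add: abs_square_less_1)
qed

lemma poincare_inv_poincare_map:
  assumes "p \<in> hyp_plane"
  shows "poincare_inv (poincare_map p) = p"
proof -
  have p1: "p$1 > 0" by (rule hyp_plane_pos[OF assms])
  have "1 - (cmod (poincare_map p))\<^sup>2 = 2 / (p$1 + 1)" "1 + (cmod (poincare_map p))\<^sup>2 = 2 * p$1 / (p$1 + 1)"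
    unfolding norm_poincare_map[OF assms] using p1 by (simp_all add: field_simps)
  then show ?thesis
    unfolding poincare_inv_def using p1
    by (simp add: poincare_map_def vec_eq_iff forall_3 add.commute)
qed

lemma inv_poincare_map: "z \<in> ball 0 1 \<Longrightarrow> inv_into hyp_plane poincare_map z = poincare_inv z"
  by (rule inv_into_f_eq)
    (auto simp: poincare_inv_in_plane poincare_map_poincare_inv intro: inj_on_inverseI poincare_inv_poincare_map)

text \<open>For \<open>x\<close> on the circle this is \<open>(cmod (x - z))\<^sup>2 / (1 - (cmod z)\<^sup>2)\<close>, the inverse of the Poisson kernel,
  written as a rational function of \<open>x\<close> so that contour integration applies.\<close>

lemma poincare_inv_null:
  assumes "z \<in> ball 0 1"
  shows "complex_of_real (poincare_inv z \<bullet> null_covector \<theta>) =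
    (cis \<theta> - z) * (1 - cnj z * cis \<theta>) / (cis \<theta> * (1 - z * cnj z))"
proof -
  have d: "0 < 1 - (cmod z)\<^sup>2" using assms by (simp add: abs_square_less_1)
  have zz: "z * cnj z = complex_of_real ((cmod z)\<^sup>2)" by (rule complex_norm_square[symmetric])
  have c: "cis \<theta> * cis (- \<theta>) = 1" by (simp add: cis_mult)
  have "complex_of_real (2 * (Re z * cos \<theta> + Im z * sin \<theta>)) = cnj z * cis \<theta> + z * cis (- \<theta>)"
    by (simp add: complex_eq_iff algebra_simps)
  moreover have "(1 - (cmod z)\<^sup>2) * (poincare_inv z \<bullet> null_covector \<theta>)
      = 1 + (cmod z)\<^sup>2 - 2 * (Re z * cos \<theta> + Im z * sin \<theta>)"
  proof -
    have "vector [1 + (cmod z)\<^sup>2, 2 * Re z, 2 * Im z] \<bullet> null_covector \<theta>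
        = 1 + (cmod z)\<^sup>2 - 2 * (Re z * cos \<theta> + Im z * sin \<theta>)"
      by (simp add: inner_null_covector algebra_simps)
    then show ?thesis unfolding poincare_inv_def inner_scaleR_left using d by simp
  qed
  ultimately have "complex_of_real ((1 - (cmod z)\<^sup>2) * (poincare_inv z \<bullet> null_covector \<theta>))
      = 1 + z * cnj z - (cnj z * cis \<theta> + z * cis (- \<theta>))"
    unfolding zz by (simp only: of_real_add of_real_diff of_real_1)
  then have "cis \<theta> * ((1 - z * cnj z) * complex_of_real (poincare_inv z \<bullet> null_covector \<theta>))
      = cis \<theta> * (1 + z * cnj z - (cnj z * cis \<theta> + z * cis (- \<theta>)))"
    by (simp add: zz)
  also have "\<dots> = (cis \<theta> - z) * (1 - cnj z * cis \<theta>)"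
    using c by algebra
  finally have eq: "cis \<theta> * ((1 - z * cnj z) * complex_of_real (poincare_inv z \<bullet> null_covector \<theta>))
      = (cis \<theta> - z) * (1 - cnj z * cis \<theta>)" .
  have "1 - z * cnj z \<noteq> 0"
  proof
    assume "1 - z * cnj z = 0"
    then have "complex_of_real (1 - (cmod z)\<^sup>2) = 0" by (simp add: zz)
    then show False using d by (simp only: of_real_eq_0_iff)
  qed
  then show ?thesis by (simp add: eq[symmetric])
qed

lemma circle_denominators_nonzero:
  assumes "z \<in> ball 0 1"
  shows "cis \<theta> - z \<noteq> 0" and "w \<in> cball 0 1 \<Longrightarrow> 1 - cnj z * w \<noteq> 0"
proof -
  show "cis \<theta> - z \<noteq> 0" using assms by auto
  assume w: "w \<in> cball 0 1"
  show "1 - cnj z * w \<noteq> 0"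
  proof
    assume "1 - cnj z * w = 0"
    then have "cmod (cnj z * w) = 1" by (simp add: eq_iff_diff_eq_0[symmetric])
    moreover have "cmod z * cmod w \<le> cmod z * 1"
      using w by (intro mult_left_mono) auto
    ultimately show False using assms by (simp add: norm_mult)
  qed
qed

text \<open>In the coordinate \<open>x = cis \<theta>\<close> the integrand is \<open>(1 - (cmod z)\<^sup>2)\<^sup>2 * x^(j+2) / ((x - z)\<^sup>2 * (1 - cnj z * x)\<^sup>2)\<close>
  and \<open>d\<theta> = dx / (\<i> * x)\<close>, so the integral is a value of the derivative of a function holomorphic on the
  closed disk, by Cauchy's formula for a double pole at \<open>z\<close>.\<close>

lemma wave_cis_power:
  assumes z: "z \<in> ball 0 1"
  shows "wave 2 (\<lambda>\<theta>. cis \<theta> ^ j) (poincare_inv z)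
    = 2 * pi * (of_nat (Suc j) * z ^ j + 2 * z * cnj z * z ^ j / (1 - z * cnj z))"
proof -
  let ?a = "1 - z * cnj z"
  define f where "f x = x ^ Suc j / (1 - cnj z * x)\<^sup>2" for x
  note nz = circle_denominators_nonzero[OF z]
  have a0: "?a \<noteq> 0" using nz(2)[of z] z by (simp add: mult.commute)
  have holo: "f holomorphic_on cball 0 1"
    unfolding f_def using nz(2) by (intro holomorphic_intros) auto
  have df: "deriv f z = of_nat (Suc j) * z ^ j / ?a\<^sup>2 + 2 * cnj z * z ^ Suc j / ?a ^ 3"
  proof -
    define b where "b = 1 - cnj z * z"
    have b: "b \<noteq> 0" "?a = b" using a0 by (simp_all add: b_def mult.commute)
    have "(f has_field_derivative (of_nat (Suc j) * z ^ j * b\<^sup>2 + z ^ Suc j * (2 * b * cnj z)) / (b\<^sup>2 * b\<^sup>2)) (at z)"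
    proof -
      have "((\<lambda>x. x ^ Suc j) has_field_derivative of_nat (Suc j) * z ^ j) (at z)"
        using DERIV_power[OF DERIV_ident, of "Suc j" z UNIV] by simp
      moreover have "((\<lambda>x. (1 - cnj z * x)\<^sup>2) has_field_derivative - (2 * b * cnj z)) (at z)"
        by (auto intro!: derivative_eq_intros simp: b_def)
      ultimately have "(f has_field_derivative (of_nat (Suc j) * z ^ j * (1 - cnj z * z)\<^sup>2
          - z ^ Suc j * - (2 * b * cnj z)) / ((1 - cnj z * z)\<^sup>2 * (1 - cnj z * z)\<^sup>2)) (at z)"
        unfolding f_def by (rule DERIV_divide) (use b(1) in \<open>simp add: b_def\<close>)
      then show ?thesis
        by (simp only: b_def[symmetric] mult_minus_right minus_minus diff_minus_eq_add)
    qed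
    moreover have "(A * b\<^sup>2 + B * (2 * b * c)) / (b\<^sup>2 * b\<^sup>2) = A / b\<^sup>2 + 2 * c * B / b ^ 3" for A B c
      using b(1) by (simp add: field_simps eval_nat_numeral)
    ultimately show ?thesis unfolding b(2) by (metis DERIV_imp_deriv)
  qed
  have "((\<lambda>x. f x / (x - z) ^ Suc 1) has_contour_integral 2 * pi * \<i> / fact 1 * (deriv ^^ 1) f z) (circlepath 0 1)"
    using holo by (intro Cauchy_has_contour_integral_higher_derivative_circlepath z
       holomorphic_on_imp_continuous_on holomorphic_on_subset[OF holo]) auto
  then have "((\<lambda>\<theta>. f (cis \<theta>) / (cis \<theta> - z)\<^sup>2 * \<i> * cis \<theta>) has_integral 2 * pi * \<i> * deriv f z) {0..2*pi}"
    by (simp add: circlepath_def has_contour_integral_part_circlepath_iff power2_eq_square)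
  from has_integral_mult_right[OF this, of "?a\<^sup>2 / \<i>"]
  have "((\<lambda>\<theta>. ?a\<^sup>2 / \<i> * (f (cis \<theta>) / (cis \<theta> - z)\<^sup>2 * \<i> * cis \<theta>)) has_integral ?a\<^sup>2 / \<i> * (2 * pi * \<i> * deriv f z)) {0..2*pi}" .
  moreover have "?a\<^sup>2 / \<i> * (f (cis \<theta>) / (cis \<theta> - z)\<^sup>2 * \<i> * cis \<theta>)
      = (1 / (poincare_inv z \<bullet> null_covector \<theta>)\<^sup>2) *\<^sub>R cis \<theta> ^ j" for \<theta>
    using nz(1)[of \<theta>] nz(2)[of "cis \<theta>"] a0
    by (simp add: scaleR_conv_of_real poincare_inv_null[OF z] f_def power_divide power_mult_distrib field_simps power2_eq_square)
  ultimately have "wave 2 (\<lambda>\<theta>. cis \<theta> ^ j) (poincare_inv z) = ?a\<^sup>2 / \<i> * (2 * pi * \<i> * deriv f z)"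
    unfolding wave_def by (simp add: integral_unique)
  also have "\<dots> = 2 * pi * (of_nat (Suc j) * z ^ j + 2 * z * cnj z * z ^ j / ?a)"
  proof -
    have "q\<^sup>2 / \<i> * (2 * pi * \<i> * (A / q\<^sup>2 + B / q ^ 3)) = 2 * pi * (A + B / q)" if "q \<noteq> 0" for q A B :: complex
      using that by (simp add: field_simps eval_nat_numeral)
    from this[OF a0] show ?thesis unfolding df by (simp only:) (simp add: mult_ac)
  qed
  finally show ?thesis .
qed

text \<open>The boundary functions \<open>1\<close>, \<open>cos\<close>, \<open>sin\<close> extend to the coordinate functions: these are the
  solutions \<open>u\<close> for which \<open>J grad u\<close> is a Killing field. Together with monotonicity this determines
  the boundary behaviour of all other extensions.\<close>

lemma wave_first_harmonics:
  assumes p: "p \<in> hyp_plane"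
  shows "wave 2 (\<lambda>\<theta>. 1) p = 2 * pi * p$1" "wave 2 cos p = 2 * pi * p$2" "wave 2 sin p = 2 * pi * p$3"
proof -
  define z where "z = poincare_map p"
  have z: "z \<in> ball 0 1" and pz: "p = poincare_inv z"
    unfolding z_def by (rule poincare_map_in_ball[OF p], simp add: poincare_inv_poincare_map[OF p])
  have pc: "p \<in> future_cone" using p hyp_plane_subset_future_cone by blast
  have d: "0 < 1 - (cmod z)\<^sup>2" using z by (simp add: abs_square_less_1)
  have zz: "z * cnj z = complex_of_real ((cmod z)\<^sup>2)" by (rule complex_norm_square[symmetric])
  have a: "1 - z * cnj z = complex_of_real (1 - (cmod z)\<^sup>2)" by (simp add: zz)
  have a0: "complex_of_real (1 - (cmod z)\<^sup>2) \<noteq> 0" using d by (simp only: of_real_eq_0_iff)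
  have "complex_of_real (wave 2 (\<lambda>\<theta>. 1) p) = wave 2 (\<lambda>\<theta>. cis \<theta> ^ 0) p"
    using wave_linear[OF bounded_linear_of_real pc, of "\<lambda>\<theta>. 1" 2] by simp
  also have "\<dots> = complex_of_real (2 * pi * p$1)"
  proof -
    have "p$1 = 1 + 2 * (cmod z)\<^sup>2 / (1 - (cmod z)\<^sup>2)"
      using d by (simp add: pz poincare_inv_def field_simps)
    then show ?thesis
      unfolding wave_cis_power[OF z, folded pz] a by (simp add: mult.assoc zz)
  qed
  finally show "wave 2 (\<lambda>\<theta>. 1) p = 2 * pi * p$1" by (simp only: of_real_eq_iff)
  have c: "wave 2 cis p = complex_of_real (4 * pi / (1 - (cmod z)\<^sup>2)) * z"
  proof -
    have "z * (cnj z * z) = complex_of_real ((cmod z)\<^sup>2) * z"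
      by (simp only: mult.assoc[symmetric] zz)
    then have "wave 2 cis p = 2 * pi * (2 * z + 2 * (complex_of_real ((cmod z)\<^sup>2) * z) / complex_of_real (1 - (cmod z)\<^sup>2))"
      using wave_cis_power[OF z, of 1] unfolding pz a by (simp add: mult.assoc)
    then show ?thesis using a0 by (simp add: field_simps)
  qed
  have cont: "continuous_on {0..2*pi} cis" by (intro continuous_intros)
  show "wave 2 cos p = 2 * pi * p$2"
    using wave_linear[OF bounded_linear_Re pc cont, of 2] c by (simp add: pz poincare_inv_def)
  show "wave 2 sin p = 2 * pi * p$3"
    using wave_linear[OF bounded_linear_Im pc cont, of 2] c by (simp add: pz poincare_inv_def)
qed

lemma wave_mono:
  fixes \<phi> \<psi> :: "real \<Rightarrow> real"
  assumes x: "x \<in> future_cone" and "continuous_on {0..2*pi} \<phi>" "continuous_on {0..2*pi} \<psi>"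
    and le: "\<And>\<theta>. \<phi> \<theta> \<le> \<psi> \<theta>"
  shows "wave n \<phi> x \<le> wave n \<psi> x"
  unfolding wave_def
  by (intro integral_le wave_integrable assms scaleR_left_mono le) (use null_covector_pos[OF x] in \<open>simp add: less_imp_le\<close>)

lemma wave_affine:
  assumes p: "p \<in> hyp_plane"
  shows "wave 2 (\<lambda>\<theta>. a + b * cos \<theta> + c * sin \<theta>) p = 2 * pi * (a * p$1 + b * p$2 + c * p$3)"
proof -
  have pc: "p \<in> future_cone" using p hyp_plane_subset_future_cone by blast
  have lin: "wave 2 (\<lambda>\<theta>. r * f \<theta>) p = r * wave 2 f p" if "continuous_on {0..2*pi} f" for f and r :: real
    using wave_linear[OF bounded_linear_mult_right pc that] by simp
  have "wave 2 (\<lambda>\<theta>. a + b * cos \<theta> + c * sin \<theta>) p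
     = wave 2 (\<lambda>\<theta>. a * 1) p + wave 2 (\<lambda>\<theta>. b * cos \<theta>) p + wave 2 (\<lambda>\<theta>. c * sin \<theta>) p"
    by (simp add: wave_add[OF pc] continuous_intros)
  also have "\<dots> = a * wave 2 (\<lambda>\<theta>. 1) p + b * wave 2 cos p + c * wave 2 sin p"
    by (subst (1 2 3) lin) (auto intro!: continuous_intros)
  finally show ?thesis by (simp add: wave_first_harmonics[OF p] algebra_simps)
qed

section \<open>Boundary values\<close>

lemma continuous_on_vector_3:
  fixes a b c :: "'a::topological_space \<Rightarrow> real"
  assumes "continuous_on S a" "continuous_on S b" "continuous_on S c"
  shows "continuous_on S (\<lambda>x. vector [a x, b x, c x] :: real^3)"
proof -
  have "(vector [a x, b x, c x] :: real^3) = a x *\<^sub>R axis 1 1 + b x *\<^sub>R axis 2 1 + c x *\<^sub>R axis 3 1" for x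
    by (simp add: vec_eq_iff forall_3 axis_def)
  then show ?thesis using assms by (simp add: continuous_intros)
qed

text \<open>Korovkin's estimate: away from \<open>z0\<close> the oscillation of \<open>\<phi>\<close> is dominated by a multiple of
  \<open>1 - z \<bullet> z0\<close>, which on the circle is half the squared distance. The majorant is an affine function
  of \<open>z\<close>, so its extension to the disk is known exactly.\<close>

lemma korovkin_bound:
  fixes \<phi> :: "complex \<Rightarrow> real"
  assumes \<phi>: "continuous_on (sphere 0 1) \<phi>" and z0: "z0 \<in> sphere 0 1" and e: "e > 0"
  obtains C :: real where "\<And>z. z \<in> sphere 0 1 \<Longrightarrow> \<bar>\<phi> z - \<phi> z0\<bar> \<le> e + C * (1 - z \<bullet> z0)"
proof -
  obtain d where d: "d > 0" "\<And>z. z \<in> sphere 0 1 \<Longrightarrow> dist z z0 < d \<Longrightarrow> dist (\<phi> z) (\<phi> z0) < e"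
    using \<phi> z0 e unfolding continuous_on_iff by metis
  have "bounded (\<phi> ` sphere 0 1)"
    by (intro compact_imp_bounded compact_continuous_image \<phi> compact_sphere)
  then obtain M where M: "\<And>z. z \<in> sphere 0 1 \<Longrightarrow> \<bar>\<phi> z\<bar> \<le> M" unfolding bounded_real by (meson imageI)
  have "\<bar>\<phi> z - \<phi> z0\<bar> \<le> e + 4 * M / d\<^sup>2 * (1 - z \<bullet> z0)" if z: "z \<in> sphere 0 1" for z
  proof -
    have n: "1 - z \<bullet> z0 = (dist z z0)\<^sup>2 / 2"
      using z z0 by (simp add: dist_norm power2_norm_eq_inner inner_diff inner_commute norm_eq_1)
    have M0: "0 \<le> M" using M[OF z] by linarith
    show ?thesis
    proof (cases "dist z z0 < d")
      case True
      then have "\<bar>\<phi> z - \<phi> z0\<bar> \<le> e" using d(2)[OF z] by (simp add: dist_real_def)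
      moreover have "0 \<le> 4 * M / d\<^sup>2 * (1 - z \<bullet> z0)" unfolding n using M0 by simp
      ultimately show ?thesis by linarith
    next
      case False
      then have "d\<^sup>2 \<le> (dist z z0)\<^sup>2" using d(1) by (intro power_mono) auto
      then have "2 * M * d\<^sup>2 \<le> 2 * M * (dist z z0)\<^sup>2" using M0 by (intro mult_left_mono) auto
      then have "2 * M \<le> 4 * M / d\<^sup>2 * (1 - z \<bullet> z0)" unfolding n using d(1) by (simp add: field_simps)
      moreover have "\<bar>\<phi> z - \<phi> z0\<bar> \<le> 2 * M" using M[OF z] M[OF z0] by linarith
      ultimately show ?thesis using e by linarith
    qed
  qed
  then show thesis by (rule that)
qed

text \<open>The extension is monotone in the boundary function and reproduces affine functions, so the
  bound of \<open>korovkin_bound\<close> persists inside the disk; as \<open>\<eta> \<longrightarrow> z0\<close> its right hand side tends to \<open>e\<close>.\<close>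

lemma wave_boundary_values:
  fixes \<phi> :: "complex \<Rightarrow> real"
  assumes \<phi>: "continuous_on (sphere 0 1) \<phi>"
    and u: "\<And>p. p \<in> hyp_plane \<Longrightarrow> u p = wave 2 (\<lambda>\<theta>. \<phi> (cis \<theta>) / (2 * pi)) p"
  shows "has_boundary_values u \<phi>"
proof -
  let ?\<psi> = "\<lambda>\<theta>. \<phi> (cis \<theta>) / (2 * pi)"
  have \<psi>: "continuous_on S ?\<psi>" for S
    by (intro continuous_intros continuous_on_compose2[OF \<phi>]) auto
  define f where "f \<eta> = (if \<eta> \<in> ball 0 1 then disk_fun u \<eta> else \<phi> \<eta>)" for \<eta>
  have bound: "\<bar>f \<eta> - \<phi> z0\<bar> \<le> e + C * (1 - \<eta> \<bullet> z0)"
    if C: "\<And>z. z \<in> sphere 0 1 \<Longrightarrow> \<bar>\<phi> z - \<phi> z0\<bar> \<le> e + C * (1 - z \<bullet> z0)" and \<eta>: "\<eta> \<in> cball 0 1" for \<eta> z0 e C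
  proof (cases "\<eta> \<in> ball 0 1")
    case False
    then have "\<eta> \<in> sphere 0 1" using \<eta> by simp
    then show ?thesis using C False by (simp add: f_def)
  next
    case True
    define p where "p = klein_inv \<eta>"
    have p: "p \<in> hyp_plane" and kp: "klein_map p = \<eta>"
      using True by (simp_all add: p_def klein_inv_in_plane klein_map_klein_inv)
    have p1: "p$1 > 0" by (rule hyp_plane_pos[OF p])
    have pc: "p \<in> future_cone" using p hyp_plane_subset_future_cone by blast
    have \<eta>p: "\<eta> \<bullet> z0 = (Re z0 * p$2 + Im z0 * p$3) / p$1"
      by (simp add: kp[symmetric] klein_map_def inner_complex_def add_divide_distrib mult.commute)
    have C': "\<bar>\<phi> (cis \<theta>) - \<phi> z0\<bar> \<le> e + C * (1 - (Re z0 * cos \<theta> + Im z0 * sin \<theta>))" for \<theta>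
      using C[of "cis \<theta>"] by (simp add: inner_complex_def mult.commute)
    have upper: "u p \<le> (\<phi> z0 + e + C) * p$1 - C * (Re z0 * p$2 + Im z0 * p$3)"
    proof -
      have "u p \<le> wave 2 (\<lambda>\<theta>. (\<phi> z0 + e + C) / (2*pi) + (- C * Re z0 / (2*pi)) * cos \<theta> + (- C * Im z0 / (2*pi)) * sin \<theta>) p"
        unfolding u[OF p]
      proof (rule wave_mono[OF pc \<psi>])
        fix \<theta>
        have "\<phi> (cis \<theta>) \<le> \<phi> z0 + e + C + (- C * Re z0) * cos \<theta> + (- C * Im z0) * sin \<theta>"
          using C'[of \<theta>] by (simp add: algebra_simps abs_le_iff)
        from divide_right_mono[OF this, of "2 * pi"]
        show "\<phi> (cis \<theta>) / (2*pi) \<le> (\<phi> z0 + e + C) / (2*pi) + (- C * Re z0 / (2*pi)) * cos \<theta> + (- C * Im z0 / (2*pi)) * sin \<theta>"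
          by (simp add: add_divide_distrib diff_divide_distrib)
      qed (intro continuous_intros)
      then show ?thesis unfolding wave_affine[OF p] by (simp add: algebra_simps add_divide_distrib)
    qed
    have lower: "u p \<ge> (\<phi> z0 - e - C) * p$1 + C * (Re z0 * p$2 + Im z0 * p$3)"
    proof -
      have "u p \<ge> wave 2 (\<lambda>\<theta>. (\<phi> z0 - e - C) / (2*pi) + (C * Re z0 / (2*pi)) * cos \<theta> + (C * Im z0 / (2*pi)) * sin \<theta>) p"
        unfolding u[OF p]
      proof (rule wave_mono[OF pc _ \<psi>])
        fix \<theta>
        have "\<phi> (cis \<theta>) \<ge> \<phi> z0 - e - C + (C * Re z0) * cos \<theta> + (C * Im z0) * sin \<theta>"
          using C'[of \<theta>] by (simp add: algebra_simps abs_le_iff)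
        from divide_right_mono[OF this, of "2 * pi"]
        show "\<phi> (cis \<theta>) / (2*pi) \<ge> (\<phi> z0 - e - C) / (2*pi) + (C * Re z0 / (2*pi)) * cos \<theta> + (C * Im z0 / (2*pi)) * sin \<theta>"
          by (simp add: add_divide_distrib diff_divide_distrib)
      qed (intro continuous_intros)
      then show ?thesis unfolding wave_affine[OF p] by (simp add: algebra_simps add_divide_distrib diff_divide_distrib)
    qed
    have "f \<eta> = u p / p$1"
      using True disk_fun_klein_map[OF p, of u] by (simp add: f_def kp)
    then show ?thesis
      using upper lower p1 unfolding \<eta>p by (simp add: abs_le_iff field_simps)
  qed
  have "continuous (at z within cball 0 1) f" if z: "z \<in> cball 0 1" for z
  proof (cases "z \<in> ball 0 1")
    case True
    have kl: "continuous_on (ball 0 1) klein_inv"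
      unfolding klein_inv_def
      by (intro continuous_intros continuous_on_vector_3) (auto simp: abs_square_eq_1)
    have wv: "continuous_on future_cone (wave 2 ?\<psi>)"
      using Ck_on_wave[OF \<psi>, of 0 2] by simp
    have "klein_inv ` ball 0 1 \<subseteq> future_cone"
      using klein_inv_in_plane hyp_plane_subset_future_cone by blast
    from continuous_on_compose2[OF wv kl this]
    have "continuous_on (ball 0 1) (\<lambda>\<eta>. wave 2 ?\<psi> (klein_inv \<eta>))" .
    then have "continuous_on (ball 0 1) (\<lambda>\<eta>. sqrt (1 - (cmod \<eta>)\<^sup>2) * wave 2 ?\<psi> (klein_inv \<eta>))"
      by (intro continuous_intros)
    then have "continuous_on (ball 0 1) f"
      by (rule continuous_on_eq) (simp add: f_def disk_fun_eq u klein_inv_in_plane)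
    then have "isCont f z" using True by (simp only: continuous_on_eq_continuous_at[OF open_ball])
    then show ?thesis by (rule continuous_at_imp_continuous_at_within)
  next
    case False
    then have z: "z \<in> sphere 0 1" using that by simp
    have fz: "f z = \<phi> z" using False by (simp add: f_def)
    show ?thesis
      unfolding continuous_within tendsto_iff
    proof (intro allI impI)
      fix \<epsilon> :: real assume \<epsilon>: "\<epsilon> > 0"
      obtain C where C: "\<And>w. w \<in> sphere 0 1 \<Longrightarrow> \<bar>\<phi> w - \<phi> z\<bar> \<le> \<epsilon>/2 + C * (1 - w \<bullet> z)"
        using korovkin_bound[OF \<phi> z, of "\<epsilon>/2"] \<epsilon> by auto
      have "((\<lambda>\<eta>. \<epsilon>/2 + C * (1 - \<eta> \<bullet> z)) \<longlongrightarrow> \<epsilon>/2 + C * (1 - z \<bullet> z)) (at z within cball 0 1)"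
        by (intro tendsto_intros)
      then have "((\<lambda>\<eta>. \<epsilon>/2 + C * (1 - \<eta> \<bullet> z)) \<longlongrightarrow> \<epsilon>/2) (at z within cball 0 1)"
        using z by (simp add: norm_eq_1)
      then have "\<forall>\<^sub>F \<eta> in at z within cball 0 1. \<epsilon>/2 + C * (1 - \<eta> \<bullet> z) < \<epsilon>"
        using order_tendstoD(2)[of _ "\<epsilon>/2" _ \<epsilon>] \<epsilon> by simp
      moreover have "\<forall>\<^sub>F \<eta> in at z within cball 0 1. \<eta> \<in> cball 0 1"
        by (simp add: eventually_at_filter)
      ultimately show "\<forall>\<^sub>F \<eta> in at z within cball 0 1. dist (f \<eta>) (f z) < \<epsilon>"
      proof eventually_elim
        case (elim \<eta>)
        then show ?case using bound[OF C, of \<eta>] by (simp add: dist_real_def fz)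
      qed
    qed
  qed
  then have "continuous_on (cball 0 1) f" by (simp add: continuous_on_eq_continuous_within)
  then show ?thesis
    unfolding has_boundary_values_def by (intro exI[of _ f]) (auto simp: f_def)
qed

section \<open>Comparison with the infinitesimal Douady-Earle extension\<close>

lemma support_fun_eq:
  assumes X: "X \<in> circle_fields" and z: "z \<in> sphere 0 1"
  shows "X z = \<i> * z * complex_of_real (support_fun X z)" and "support_fun X z = Im (X z * cnj z)"
proof -
  have zz: "z * cnj z = 1" using z by (simp add: complex_norm_square[symmetric])
  have Xz: "Re (X z * cnj z) = 0"
    using X z by (simp add: circle_fields_def inner_complex_def)
  \<comment> \<open>Multiplication by \<open>cnj z\<close>, the inverse of \<open>z\<close>, isolates \<open>\<i> * r\<close>.\<close>
  have eq: "X z = \<i> * z * complex_of_real r \<longleftrightarrow> r = Im (X z * cnj z)" for r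
  proof
    assume "X z = \<i> * z * complex_of_real r"
    then have "X z * cnj z = \<i> * complex_of_real r * (z * cnj z)" by (simp add: mult_ac)
    then show "r = Im (X z * cnj z)" by (simp add: zz)
  next
    assume "r = Im (X z * cnj z)"
    then have "X z * cnj z = \<i> * complex_of_real r" using Xz by (simp add: complex_eq_iff)
    then have "X z * (cnj z * z) = \<i> * z * complex_of_real r" by (simp add: mult_ac)
    then show "X z = \<i> * z * complex_of_real r" using zz by (simp add: mult.commute)
  qed
  show s: "support_fun X z = Im (X z * cnj z)"
    unfolding support_fun_def eq by simp
  show "X z = \<i> * z * complex_of_real (support_fun X z)" unfolding eq s ..
qed

lemma continuous_on_support_fun:
  assumes X: "X \<in> circle_fields"
  shows "continuous_on (sphere 0 1) (support_fun X)"
proof -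
  have "continuous_on (sphere 0 1) (\<lambda>z. Im (X z * cnj z))"
    using X by (intro continuous_intros) (simp add: circle_fields_def)
  then show ?thesis by (rule continuous_on_eq) (simp add: support_fun_eq(2)[OF X])
qed

text \<open>The superposition satisfies the conditions defining \<open>u_of\<close>, and the comparison in both
  directions shows that nothing else does.\<close>

lemma u_of_eq:
  assumes X: "X \<in> circle_fields" and p: "p \<in> hyp_plane"
  shows "u_of X p = wave 2 (\<lambda>\<theta>. support_fun X (cis \<theta>) / (2 * pi)) p"
proof -
  let ?\<psi> = "\<lambda>\<theta>. support_fun X (cis \<theta>) / (2 * pi)"
  define u where "u = restrict (wave 2 ?\<psi>) hyp_plane"
  have u: "u p = wave 2 ?\<psi> p" if "p \<in> hyp_plane" for p using that by (simp add: u_def)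
  have \<psi>: "continuous_on {0..2*pi} ?\<psi>"
    by (intro continuous_intros continuous_on_compose2[OF continuous_on_support_fun[OF X]]) auto
  have smooth: "hyp_smooth u"
    unfolding hyp_smooth_def
    using open_future_cone hyp_plane_subset_future_cone Ck_on_wave[OF \<psi>, of _ 2] u by blast
  have lap: "hyp_laplace u p = 2 * u p" if "p \<in> hyp_plane" for p
    by (rule hyp_laplace_wave[OF that \<psi> u])
  have bv: "has_boundary_values u (support_fun X)"
    by (rule wave_boundary_values[OF continuous_on_support_fun[OF X] u])
  have "u_of X = u"
    unfolding u_of_def
  proof (rule the_equality)
    show "u \<in> extensional hyp_plane \<and> hyp_smooth u \<and> (\<forall>p\<in>hyp_plane. hyp_laplace u p - 2 * u p = 0) \<and>
        has_boundary_values u (support_fun X)"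
      using smooth lap bv by (simp add: u_def)
    fix v assume v: "v \<in> extensional hyp_plane \<and> hyp_smooth v \<and> (\<forall>p\<in>hyp_plane. hyp_laplace v p - 2 * v p = 0) \<and>
        has_boundary_values v (support_fun X)"
    show "v = u"
    proof (rule extensionalityI[of _ hyp_plane])
      fix q assume q: "q \<in> hyp_plane"
      have "v q \<le> u q" by (rule hyp_laplace_comparison[OF _ _ _ smooth lap bv q]) (use v in auto)
      moreover have "u q \<le> v q" by (rule hyp_laplace_comparison[OF smooth lap bv _ _ _ q]) (use v in auto)
      ultimately show "v q = u q" by simp
    qed (use v in \<open>auto simp: u_def\<close>)
  qed
  then show ?thesis using u[OF p] by simp
qed

lemma boxtimes_eq:
  "boxtimes x y = vector [x$3 * y$2 - x$2 * y$3, x$3 * y$1 - x$1 * y$3, x$1 * y$2 - x$2 * y$1]"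
  using mink_boxtimes[of x y "axis 1 1"] mink_boxtimes[of x y "axis 2 1"] mink_boxtimes[of x y "axis 3 1"]
  by (simp add: mink_def axis_def vec_eq_iff forall_3 det_3)

lemma boxtimes_hyp_proj: "boxtimes p (hyp_proj p w) = boxtimes p w"
  by (simp add: boxtimes_eq hyp_proj_def algebra_simps vec_eq_iff forall_3)

lemma boxtimes_tangent: "boxtimes p w \<in> hyp_tangent p"
  by (simp add: hyp_tangent_def boxtimes_eq mink_def algebra_simps)

lemma hyp_diff_poincare_map:
  assumes z: "z \<in> ball 0 1" and v: "v \<in> hyp_tangent (poincare_inv z)"
  shows "hyp_diff poincare_map (poincare_inv z) v
    = ((1 - (cmod z)\<^sup>2) / 2) *\<^sub>R (Complex (v$2) (v$3) - v$1 *\<^sub>R z)"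
proof -
  let ?p = "poincare_inv z"
  have p: "?p \<in> hyp_plane" by (rule poincare_inv_in_plane[OF z])
  have d: "0 < 1 - (cmod z)\<^sup>2" using z by (simp add: abs_square_less_1)
  have p1: "1 + ?p$1 = 2 / (1 - (cmod z)\<^sup>2)"
    using d by (simp add: poincare_inv_def field_simps)
  have ne: "1 + ?p$1 \<noteq> 0" using hyp_plane_pos[OF p] by simp
  define c :: "real^3 \<Rightarrow> complex" where "c x = Complex (x$2) (x$3)" for x
  have "bounded_linear c"
    unfolding c_def by (intro linear_conv_bounded_linear[THEN iffD1] linearI) (auto simp: complex_eq_iff)
  then have dc: "(c has_derivative c) (at ?p)" by (rule bounded_linear_imp_has_derivative)
  have pm: "poincare_map = (\<lambda>x. inverse (1 + x$1) *\<^sub>R c x)"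
    by (simp add: fun_eq_iff poincare_map_def c_def complex_eq_iff divide_inverse)
  have D: "(poincare_map has_derivative (\<lambda>h. inverse (1 + ?p$1) *\<^sub>R c h
      + (- (inverse (1 + ?p$1) * h$1 * inverse (1 + ?p$1))) *\<^sub>R c ?p)) (at ?p)"
    unfolding pm using ne
    by (auto intro!: derivative_eq_intros dc bounded_linear.has_derivative[OF bounded_linear_vec_nth])
  have "hyp_diff poincare_map ?p v = inverse (1 + ?p$1) *\<^sub>R c v
      + (- (inverse (1 + ?p$1) * v$1 * inverse (1 + ?p$1))) *\<^sub>R c ?p"
    using hyp_diff_unique[OF has_derivative_at_withinI[OF D] p v] .
  also have "\<dots> = inverse (1 + ?p$1) *\<^sub>R (c v - v$1 *\<^sub>R (inverse (1 + ?p$1) *\<^sub>R c ?p))"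
    by (simp add: scaleR_diff_right mult_ac)
  also have "inverse (1 + ?p$1) *\<^sub>R c ?p = z"
    using poincare_map_poincare_inv[OF z] by (simp add: pm)
  finally show ?thesis by (simp add: p1 c_def)
qed

text \<open>The image under \<open>dG \<circ> J\<close> of the gradient of the null coordinate \<open>x \<bullet> null_covector \<theta>\<close>; the
  field \<open>HL X\<close> is a superposition of such vectors. The projection contained in \<open>hyp_grad\<close> drops out
  because \<open>boxtimes p p = 0\<close>.\<close>

lemma rotated_kernel:
  assumes z: "z \<in> ball 0 1" and w_def: "w = boxtimes (poincare_inv z) (mink_flip (null_covector \<theta>))"
  shows "((1 - (cmod z)\<^sup>2) / 2) *\<^sub>R (Complex (w$2) (w$3) - w$1 *\<^sub>R z) = - (\<i> / 2) * (cis \<theta> - z)\<^sup>2 * cis (- \<theta>)"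
proof -
  define d where "d = 1 - (cmod z)\<^sup>2"
  define m where "m = (cmod z)\<^sup>2"
  have d: "0 < d" using z by (simp add: abs_square_less_1 d_def)
  have dm: "1 - m = d" by (simp add: d_def m_def)
  have w: "d * w$1 = 2 * (Re z * sin \<theta> - Im z * cos \<theta>)"
    "d * w$2 = (1 + m) * sin \<theta> - 2 * Im z" "d * w$3 = 2 * Re z - (1 + m) * cos \<theta>"
    using d unfolding w_def boxtimes_eq poincare_inv_def m_def[symmetric] dm
    by (simp_all add: mink_flip_def null_covector_def axis_def field_simps)
  have m: "complex_of_real m = z * cnj z" unfolding m_def by (rule complex_norm_square)
  have c: "cis \<theta> * cis (- \<theta>) = 1" by (simp add: cis_mult)
  have "complex_of_real d * (Complex (w$2) (w$3) - w$1 *\<^sub>R z)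
      = Complex (d * w$2) (d * w$3) - complex_of_real (d * w$1) * z"
    by (simp add: complex_eq_iff algebra_simps)
  also have "Complex (d * w$2) (d * w$3) = 2 * \<i> * z - \<i> * ((1 + m) * cis \<theta>)"
    unfolding w by (simp add: complex_eq_iff)
  also have "complex_of_real (d * w$1) = - \<i> * (cnj z * cis \<theta> - z * cis (- \<theta>))"
    unfolding w by (simp add: complex_eq_iff)
  also have "2 * \<i> * z - \<i> * ((1 + m) * cis \<theta>) - - \<i> * (cnj z * cis \<theta> - z * cis (- \<theta>)) * z
      = - \<i> * (cis \<theta> - z)\<^sup>2 * cis (- \<theta>)"
    unfolding of_real_add m of_real_1 using c by algebra
  finally show ?thesis
    unfolding d_def[symmetric] by (simp add: scaleR_conv_of_real)
qed

theorem proposition1p5: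
  fixes X :: "complex \<Rightarrow> complex"
  assumes "X \<in> circle_fields"
  shows "\<forall>z\<in>ball 0 1. poincare_push (HL X) z = L0 X z"
proof
  fix z :: complex assume z: "z \<in> ball 0 1"
  note X = assms
  let ?l = null_covector
  let ?\<phi> = "support_fun X"
  define \<psi> where "\<psi> \<theta> = ?\<phi> (cis \<theta>) / (2 * pi)" for \<theta>
  define p where "p = poincare_inv z"
  define r where "r = 1 - z * cnj z"
  have p: "p \<in> hyp_plane" unfolding p_def by (rule poincare_inv_in_plane[OF z])
  have pc: "p \<in> future_cone" using p hyp_plane_subset_future_cone by blast
  have \<psi>: "continuous_on {0..2*pi} \<psi>"
    unfolding \<psi>_def by (intro continuous_intros continuous_on_compose2[OF continuous_on_support_fun[OF X]]) auto
  have cont: "continuous_on {0..2*pi} (\<lambda>\<theta>. (- 2 * \<psi> \<theta>) *\<^sub>R ?l \<theta>)"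
    by (intro continuous_intros \<psi>)
  have grad: "hyp_grad (u_of X) p = hyp_proj p (mink_flip (wave 3 (\<lambda>\<theta>. (- 2 * \<psi> \<theta>) *\<^sub>R ?l \<theta>) p))"
  proof (rule hyp_grad_eq[OF p])
    have "(wave 2 \<psi> has_derivative (\<bullet>) (wave 3 (\<lambda>\<theta>. (- 2 * \<psi> \<theta>) *\<^sub>R ?l \<theta>) p)) (at p within hyp_plane)"
      by (rule has_derivative_at_withinI[OF wave_gradient[OF pc \<psi>]])
    moreover have "u_of X x = wave 2 \<psi> x" if "x \<in> hyp_plane" for x
      using u_of_eq[OF X that] by (simp add: \<psi>_def[abs_def])
    ultimately show "(u_of X has_derivative (\<bullet>) (wave 3 (\<lambda>\<theta>. (- 2 * \<psi> \<theta>) *\<^sub>R ?l \<theta>) p)) (at p within hyp_plane)"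
      using has_derivative_transform[OF p] by blast
  qed
  define T where "T a = ((1 - (cmod z)\<^sup>2) / 2) *\<^sub>R (Complex (boxtimes p (mink_flip a) $ 2) (boxtimes p (mink_flip a) $ 3)
     - (boxtimes p (mink_flip a) $ 1) *\<^sub>R z)" for a
  have T: "bounded_linear T"
    unfolding T_def
    by (intro linear_conv_bounded_linear[THEN iffD1] linearI)
       (simp_all add: boxtimes_eq mink_flip_def complex_eq_iff algebra_simps add_divide_distrib diff_divide_distrib)
  have "poincare_push (HL X) z = T (wave 3 (\<lambda>\<theta>. (- 2 * \<psi> \<theta>) *\<^sub>R ?l \<theta>) p)"
    by (simp add: poincare_push_def Let_def inv_poincare_map[OF z] p_def[symmetric] HL_def hyp_J_def grad boxtimes_hyp_proj T_def
        hyp_diff_poincare_map[OF z, folded p_def] boxtimes_tangent)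
  also have "\<dots> = wave 3 (\<lambda>\<theta>. T ((- 2 * \<psi> \<theta>) *\<^sub>R ?l \<theta>)) p"
    by (rule wave_linear[OF T pc cont])
  also have "(\<lambda>\<theta>. T ((- 2 * \<psi> \<theta>) *\<^sub>R ?l \<theta>)) = (\<lambda>\<theta>. \<psi> \<theta> * \<i> * (cis \<theta> - z)\<^sup>2 * cis (- \<theta>))"
  proof
    fix \<theta>
    have "T (?l \<theta>) = - (\<i> / 2) * (cis \<theta> - z)\<^sup>2 * cis (- \<theta>)"
      unfolding T_def p_def by (rule rotated_kernel[OF z refl])
    then show "T ((- 2 * \<psi> \<theta>) *\<^sub>R ?l \<theta>) = \<psi> \<theta> * \<i> * (cis \<theta> - z)\<^sup>2 * cis (- \<theta>)"
      unfolding linear_cmul[OF bounded_linear.linear[OF T]] by (simp add: scaleR_conv_of_real)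
  qed
  also have "wave 3 (\<lambda>\<theta>. \<psi> \<theta> * \<i> * (cis \<theta> - z)\<^sup>2 * cis (- \<theta>)) p
      = integral {0..2*pi} (\<lambda>\<theta>. r ^ 3 / (2 * \<i> * pi) *
          (X (cis \<theta>) / ((1 - cnj z * cis \<theta>) ^ 3 * (cis \<theta> - z)) * \<i> * cis \<theta>))"
    unfolding wave_def
  proof (rule integral_cong)
    fix \<theta>
    note nz = circle_denominators_nonzero[OF z]
    \<comment> \<open>With \<open>1 / (p \<bullet> ?l \<theta>)^3 = (x * r)^3 / ((x - z) * y)^3\<close> the factor \<open>(x - z)\<^sup>2 / x\<close> cancels all but one
       of the factors \<open>x - z\<close> and leaves \<open>x\<^sup>2\<close>: one \<open>x\<close> belongs to \<open>X x\<close>, the other to \<open>dx\<close>.\<close>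
    obtain x y where x: "x = cis \<theta>" and y: "y = 1 - cnj z * x" by simp
    have x0: "x \<noteq> 0" and xz: "x - z \<noteq> 0" and y0: "y \<noteq> 0"
      using nz(1)[of \<theta>] nz(2)[of "cis \<theta>"] by (simp_all add: x y)
    have "1 - z * cnj z \<noteq> 0" using nz(2)[of z] z by (simp add: mult.commute)
    then have r0: "r \<noteq> 0" by (simp add: r_def)
    have Xx: "X x = \<i> * x * (2 * pi * \<psi> \<theta>)"
      using support_fun_eq(1)[OF X, of "cis \<theta>"] by (simp add: \<psi>_def x)
    have xi: "cis (- \<theta>) = 1 / x" unfolding x by (simp add: cis_inverse divide_inverse)
    have "(1 / (p \<bullet> ?l \<theta>) ^ 3) *\<^sub>R (\<psi> \<theta> * \<i> * (cis \<theta> - z)\<^sup>2 * cis (- \<theta>))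
      = 1 / ((x - z) * y / (x * r)) ^ 3 * (\<psi> \<theta> * \<i> * (x - z)\<^sup>2 * (1 / x))"
      by (simp add: scaleR_conv_of_real p_def poincare_inv_null[OF z] x y r_def xi[unfolded x])
    also have "\<dots> = r ^ 3 / (2 * \<i> * pi) * (X x / (y ^ 3 * (x - z)) * \<i> * x)"
    proof -
      have "1 / (s * y / (x * r)) ^ 3 * (w * \<i> * s\<^sup>2 * (1 / x))
          = r ^ 3 / (2 * \<i> * pi) * (\<i> * x * (2 * pi * w) / (y ^ 3 * s) * \<i> * x)" if "s \<noteq> 0" for s w
        using x0 that y0 r0 by (simp add: field_simps eval_nat_numeral)
      from this[OF xz] show ?thesis unfolding Xx .
    qed
    finally show "(1 / (p \<bullet> ?l \<theta>) ^ 3) *\<^sub>R (\<psi> \<theta> * \<i> * (cis \<theta> - z)\<^sup>2 * cis (- \<theta>)) =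
      r ^ 3 / (2 * \<i> * pi) * (X (cis \<theta>) / ((1 - cnj z * cis \<theta>) ^ 3 * (cis \<theta> - z)) * \<i> * cis \<theta>)"
      by (simp add: x y)
  qed
  also have "\<dots> = r ^ 3 / (2 * \<i> * pi) * contour_integral (circlepath 0 1) (\<lambda>x. X x / ((1 - cnj z * x) ^ 3 * (x - z)))"
  proof -
    have "contour_integral (circlepath 0 1) (\<lambda>x. X x / ((1 - cnj z * x) ^ 3 * (x - z)))
        = integral {0..2*pi} (\<lambda>\<theta>. X (cis \<theta>) / ((1 - cnj z * cis \<theta>) ^ 3 * (cis \<theta> - z)) * \<i> * cis \<theta>)"
      unfolding circlepath_def by (subst contour_integral_part_circlepath_eq) simp_all
    then show ?thesis by (simp only: integral_mult_right)
  qed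
  also have "\<dots> = L0 X z"
    unfolding L0_def r_def complex_norm_square[symmetric] by simp
  finally show "poincare_push (HL X) z = L0 X z" .
qed

end
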